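(* Let $0<H<1$ and let $W^{(H)}$ be fractional Brownian motion with parameter $H$. For $T>0$ let $f_T$ be the minimizer of \[ \mathcal{E}_T(f,W^{(H)})=\int_0^T\left[(f(s)-W^{(H)}(s))^2+f'(s)^2\right]ds \] over $f\in\mathbb{W}_2^1[0,T]$. Then the limit constant $\mathcal{C}=\lim_{T\to\infty}T^{-1}\,\mathbb{E}\,\mathcal{E}_T(f_T,W^{(H)})$ is \[ \mathcal{C}=\int_{\mathbb{R}\setminus\{0\}}\frac{u^2}{1+u^2}\,\frac{M_H\,du}{|u|^{2H+1}}=M_H\cdot\frac{\pi}{\sin(\pi H)}=\frac{\Gamma(2H+1)}{2},\qquad M_H:=\frac{\Gamma(2H+1)\sin(\pi H)}{2\pi}. \] In particular, for the Wiener process ($H=\tfrac12$), $\mathcal{C}=\tfrac12$.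
   Context: Fractional Brownian motion $W^{(H)}(t)$, $t\in\mathbb{R}$, $0<H<1$, is the real-valued centered Gaussian process with stationary increments, $W^{(H)}(0)=0$, $\mathbb{E}|W^{(H)}(t)|^2=|t|^{2H}$; it has the spectral representation $W^{(H)}(t)=\int_{\mathbb{R}\setminus\{0\}}(e^{itu}-1)X(du)$ (no linear drift term), where $X$ is a zero-mean complex Gaussian uncorrelated random measure with $X(-A)=\overline{X(A)}$ and spectral measure $\mathbb{E}|X(du)|^2=M_H\,|u|^{-2H-1}du$. A measurable version is used. $\mathbb{W}_2^1[0,T]$ denotes the space of absolutely continuous functions $f:[0,T]\to\mathbb{R}$ with square integrable derivative; the minimizer $f_T$ exists, is unique, and is taken path by path. *)

theory Defs
  imports "HOL-Probability.Probability"
begin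

definition centered_gaussian :: "'a measure \<Rightarrow> ('a \<Rightarrow> real) \<Rightarrow> bool" where
  "centered_gaussian M X \<longleftrightarrow>
     X \<in> borel_measurable M \<and>
     ((\<exists>\<sigma>>0. distributed M lborel X (\<lambda>x. ennreal (normal_density 0 \<sigma> x))) \<or>
      (AE \<omega> in M. X \<omega> = 0))"

definition centered_gaussian_process :: "'a measure \<Rightarrow> ('t \<Rightarrow> 'a \<Rightarrow> real) \<Rightarrow> bool" where
  "centered_gaussian_process M W \<longleftrightarrow>
     (\<forall>J c. finite J \<longrightarrow> centered_gaussian M (\<lambda>\<omega>. \<Sum>t\<in>J. c t * W t \<omega>))"

definition stationary_increments :: "'a measure \<Rightarrow> (real \<Rightarrow> 'a \<Rightarrow> real) \<Rightarrow> bool" where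
  "stationary_increments M W \<longleftrightarrow>
     (\<forall>J h. finite J \<longrightarrow>
        distr M (\<Pi>\<^sub>M t\<in>J. borel) (\<lambda>\<omega>. \<lambda>t\<in>J. W (t + h) \<omega> - W h \<omega>) =
        distr M (\<Pi>\<^sub>M t\<in>J. borel) (\<lambda>\<omega>. \<lambda>t\<in>J. W t \<omega> - W 0 \<omega>))"

locale fractional_brownian_motion = prob_space M for M :: "'a measure" +
  fixes H :: real and W :: "real \<Rightarrow> 'a \<Rightarrow> real"
  assumes H_pos: "0 < H" and H_less_1: "H < 1"
    and jointly_measurable: "(\<lambda>(t, \<omega>). W t \<omega>) \<in> borel_measurable (borel \<Otimes>\<^sub>M M)"
    and gaussian: "centered_gaussian_process M W"
    and stationary: "stationary_increments M W"
    and start_zero: "AE \<omega> in M. W 0 \<omega> = 0"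
    and second_moment: "\<And>t. expectation (\<lambda>\<omega>. (W t \<omega>)\<^sup>2) = \<bar>t\<bar> powr (2 * H)"

definition abs_continuous_on :: "real \<Rightarrow> real \<Rightarrow> (real \<Rightarrow> real) \<Rightarrow> bool" where
  "abs_continuous_on a b f \<longleftrightarrow>
     (\<forall>\<epsilon>>0. \<exists>\<delta>>0. \<forall>(n::nat) l r.
        (\<forall>i<n. a \<le> l i \<and> l i \<le> r i \<and> r i \<le> b) \<and>
        disjoint_family_on (\<lambda>i. {l i<..<r i}) {..<n} \<and>
        (\<Sum>i<n. r i - l i) < \<delta> \<longrightarrow>
        (\<Sum>i<n. \<bar>f (r i) - f (l i)\<bar>) < \<epsilon>)"

text \<open>Functions on \<open>[0,T]\<close> are represented by functions on the reals that are \<open>undefined\<close>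
  outside \<open>{0..T}\<close>, so that a minimizer can be unique. Since \<open>deriv\<close> is a total operator, the
  almost everywhere differentiability (automatic for absolutely continuous functions) is
  spelled out; the values of \<open>deriv f\<close> at the two endpoints are irrelevant.\<close>

definition sobolev_W21 :: "real \<Rightarrow> (real \<Rightarrow> real) set" where
  "sobolev_W21 T = {f \<in> extensional {0..T}.
     abs_continuous_on 0 T f \<and>
     (AE s in lebesgue_on {0..T}. f differentiable (at s)) \<and>
     integrable (lebesgue_on {0..T}) (\<lambda>s. (deriv f s)\<^sup>2)}"

text \<open>The energy has values in \<open>[0,\<infinity>]\<close>; it is infinite for a path \<open>w\<close> that is not square
  integrable on \<open>[0,T]\<close>.\<close>

definition energy :: "real \<Rightarrow> (real \<Rightarrow> real) \<Rightarrow> (real \<Rightarrow> real) \<Rightarrow> ennreal" where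
  "energy T f w =
     (\<integral>\<^sup>+s. ennreal ((f s - w s)\<^sup>2 + (deriv f s)\<^sup>2) \<partial>lebesgue_on {0..T})"

definition is_energy_minimizer :: "real \<Rightarrow> (real \<Rightarrow> real) \<Rightarrow> (real \<Rightarrow> real) \<Rightarrow> bool" where
  "is_energy_minimizer T w f \<longleftrightarrow>
     f \<in> sobolev_W21 T \<and> (\<forall>g \<in> sobolev_W21 T. energy T f w \<le> energy T g w)"

text \<open>Meaningful when \<open>w\<close> is square integrable on \<open>[0,T]\<close>, as almost all paths of fractional
  Brownian motion are.\<close>

definition energy_minimizer :: "real \<Rightarrow> (real \<Rightarrow> real) \<Rightarrow> (real \<Rightarrow> real)" where
  "energy_minimizer T w = (THE f. is_energy_minimizer T w f)"

definition spectral_const :: "real \<Rightarrow> real" where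
  "spectral_const H = Gamma (2 * H + 1) * sin (pi * H) / (2 * pi)"

end

theory Submission
  imports Defs
begin

text \<open>For a path \<open>w\<close> that is square integrable on \<open>[0,T]\<close>, the energy is a strictly convex
  quadratic functional, and its minimizer solves the Neumann problem
  \<open>f - f'' = w\<close>, \<open>f'(0) = f'(T) = 0\<close>. Hence \<open>f\<close> is the integral of \<open>w\<close> against the Green function
  \<open>G(s,t) = cosh (min s t) cosh (T - max s t) / sinh T\<close> of that problem. The weak form of the
  equation, tested with \<open>f\<close> itself, evaluates the minimal energy as
  \<open>\<integral> w\<^sup>2 - \<integral> f w\<close>. Constants solve the problem with \<open>w\<close> constant, so \<open>\<integral> G(s,t) dt = 1\<close>, and
  with the symmetry of \<open>G\<close> the minimal energy becomes
  \<open>1/2 \<integral>\<integral> G(s,t) (w(s) - w(t))\<^sup>2 ds dt\<close>.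

  This form depends on the path through squared increments and has a nonnegative integrand.
  By Tonelli and stationarity of increments, its mean is
  \<open>1/2 \<integral>\<integral> G(s,t) |s - t| powr (2 * H) ds dt\<close>. After \<open>s = T\<sigma>\<close>, \<open>t = s + x\<close> and division by \<open>T\<close> the
  domain is a strip, where \<open>G\<close> is dominated by \<open>4 exp (-|x|)\<close> and converges to the Green function
  \<open>exp (-|x|) / 2\<close> of the whole line. Dominated convergence gives
  \<open>1/4 \<integral> |x| powr (2 * H) exp (-|x|) dx = Gamma (2 * H + 1) / 2\<close>.

  The spectral integral is evaluated separately: the substitution \<open>v = u\<^sup>2 / (1 + u\<^sup>2)\<close> turns it
  into the Beta integral \<open>B(1 - H, H) = \<pi> / sin (\<pi> H)\<close>.

  The measure-theoretic core of the variational part is the fundamental theorem of calculus for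
  absolutely continuous functions (\<open>abs_continuous_fundamental_theorem\<close>) and an integration by
  parts for indefinite integrals (\<open>primitive_by_parts\<close>), which is the right tool because the
  derivative of the minimizer is the indefinite integral of \<open>f - w\<close> with a merely square
  integrable \<open>w\<close>.\<close>

section \<open>The fundamental theorem of calculus for absolutely continuous functions\<close>

lemma abs_continuous_on_subinterval:
  assumes "abs_continuous_on a b f" "a \<le> c" "d \<le> b"
  shows "abs_continuous_on c d f"
  unfolding abs_continuous_on_def
proof (intro allI impI)
  fix e :: real assume "e > 0"
  then obtain \<delta> where "\<delta> > 0" and \<delta>: "\<And>(n::nat) l r. (\<forall>i<n. a \<le> l i \<and> l i \<le> r i \<and> r i \<le> b) \<and>
        disjoint_family_on (\<lambda>i. {l i<..<r i}) {..<n} \<and> (\<Sum>i<n. r i - l i) < \<delta> \<Longrightarrow>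
        (\<Sum>i<n. \<bar>f (r i) - f (l i)\<bar>) < e"
    using assms(1) unfolding abs_continuous_on_def by meson
  show "\<exists>\<delta>>0. \<forall>(n::nat) l r. (\<forall>i<n. c \<le> l i \<and> l i \<le> r i \<and> r i \<le> d) \<and>
        disjoint_family_on (\<lambda>i. {l i<..<r i}) {..<n} \<and> (\<Sum>i<n. r i - l i) < \<delta> \<longrightarrow>
        (\<Sum>i<n. \<bar>f (r i) - f (l i)\<bar>) < e"
    by (rule exI[of _ \<delta>], intro conjI allI impI \<open>\<delta> > 0\<close> \<delta>)
      (use assms(2,3) in \<open>auto intro: order_trans\<close>)
qed

lemma abs_continuous_on_lipschitz:
  assumes "\<And>x y. \<lbrakk>a \<le> x; x \<le> y; y \<le> b\<rbrakk> \<Longrightarrow> \<bar>f y - f x\<bar> \<le> C * (y - x)"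
  shows "abs_continuous_on a b f"
  unfolding abs_continuous_on_def
proof (intro allI impI)
  fix e :: real assume "e > 0"
  define C' where "C' = max C 1"
  have C': "C' > 0" "C \<le> C'" by (auto simp: C'_def)
  show "\<exists>\<delta>>0. \<forall>(n::nat) l r. (\<forall>i<n. a \<le> l i \<and> l i \<le> r i \<and> r i \<le> b) \<and>
        disjoint_family_on (\<lambda>i. {l i<..<r i}) {..<n} \<and> (\<Sum>i<n. r i - l i) < \<delta> \<longrightarrow>
        (\<Sum>i<n. \<bar>f (r i) - f (l i)\<bar>) < e"
  proof (intro exI[of _ "e / C'"] conjI allI impI)
    show "e / C' > 0" using \<open>e > 0\<close> C' by simp
    fix n :: nat and l r :: "nat \<Rightarrow> real"
    assume *: "(\<forall>i<n. a \<le> l i \<and> l i \<le> r i \<and> r i \<le> b) \<and>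
        disjoint_family_on (\<lambda>i. {l i<..<r i}) {..<n} \<and> (\<Sum>i<n. r i - l i) < e / C'"
    have "(\<Sum>i<n. \<bar>f (r i) - f (l i)\<bar>) \<le> (\<Sum>i<n. C' * (r i - l i))"
    proof (rule sum_mono)
      fix i assume "i \<in> {..<n}"
      then have "\<bar>f (r i) - f (l i)\<bar> \<le> C * (r i - l i)" "r i - l i \<ge> 0" using * assms by auto
      then show "\<bar>f (r i) - f (l i)\<bar> \<le> C' * (r i - l i)"
        using mult_right_mono[OF C'(2)] by fastforce
    qed
    also have "\<dots> = C' * (\<Sum>i<n. r i - l i)" by (simp add: sum_distrib_left)
    also have "\<dots> < e" using * C' by (simp add: field_simps)
    finally show "(\<Sum>i<n. \<bar>f (r i) - f (l i)\<bar>) < e" .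
  qed
qed

text \<open>Tagged partial divisions come without an order, while absolute continuity is stated for
  finite sequences of intervals; the measure bound and the enumeration below bridge the two.\<close>
lemma sum_length_disjoint_intervals_le:
  fixes l r :: "'i \<Rightarrow> real"
  assumes "finite I" "\<And>i. i \<in> I \<Longrightarrow> l i \<le> r i"
    and "disjoint_family_on (\<lambda>i. {l i<..<r i}) I"
    and "\<And>i. i \<in> I \<Longrightarrow> {l i<..<r i} \<subseteq> U" and "U \<in> sets lebesgue"
    and "emeasure lebesgue U \<le> ennreal \<delta>" "\<delta> \<ge> 0"
  shows "(\<Sum>i\<in>I. r i - l i) \<le> \<delta>"
proof -
  have "ennreal (\<Sum>i\<in>I. r i - l i) = (\<Sum>i\<in>I. emeasure lebesgue {l i<..<r i})"
    using assms(2) by (simp add: sum_ennreal[symmetric] del: sum_ennreal)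
  also have "\<dots> = emeasure lebesgue (\<Union>i\<in>I. {l i<..<r i})"
    by (rule sum_emeasure) (use assms in auto)
  also have "\<dots> \<le> emeasure lebesgue U"
    by (rule emeasure_mono) (use assms in auto)
  also have "\<dots> \<le> ennreal \<delta>" by fact
  finally show ?thesis using assms by simp
qed

lemma abs_continuous_small_on_tagged:
  fixes f :: "real \<Rightarrow> real"
  assumes \<delta>: "\<And>(n::nat) l r. \<lbrakk>\<forall>i<n. a \<le> l i \<and> l i \<le> r i \<and> r i \<le> b;
        disjoint_family_on (\<lambda>i. {l i<..<r i}) {..<n}; (\<Sum>i<n. r i - l i) < \<delta>\<rbrakk> \<Longrightarrow>
        (\<Sum>i<n. \<bar>f (r i) - f (l i)\<bar>) < e"
    and p: "p tagged_partial_division_of {a..b}"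
    and U: "U \<in> sets lebesgue" "emeasure lebesgue U < ennreal \<delta>"
    and sub: "\<And>x K. (x, K) \<in> p \<Longrightarrow> K \<subseteq> U"
  shows "(\<Sum>(x,K)\<in>p. \<bar>f (Sup K) - f (Inf K)\<bar>) < e"
proof -
  have fin: "finite p" using p by (rule tagged_partial_division_ofD(1))
  have K: "Inf K \<le> Sup K \<and> a \<le> Inf K \<and> Sup K \<le> b \<and> {Inf K<..<Sup K} = interior K \<and> K = {Inf K..Sup K}"
    if xK: "(x, K) \<in> p" for x K
  proof -
    from p xK obtain u v where "K = cbox u v" "x \<in> K" "K \<subseteq> {a..b}"
      using tagged_partial_division_ofD by metis
    then have "K = {u..v}" "u \<le> v" "{u..v} \<subseteq> {a..b}" by auto
    then show ?thesis by auto
  qed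
  obtain h where h: "bij_betw h {..<card p} p"
    using ex_bij_betw_nat_finite[OF fin] by (auto simp: atLeast0LessThan)
  then have hp: "h i \<in> p" if "i < card p" for i using that by (auto simp: bij_betw_def)
  define l where "l i = Inf (snd (h i))" for i
  define r where "r i = Sup (snd (h i))" for i
  have lr: "l i \<le> r i \<and> a \<le> l i \<and> r i \<le> b \<and> {l i<..<r i} = interior (snd (h i)) \<and> snd (h i) \<subseteq> U"
    if "i < card p" for i
    using K[of "fst (h i)" "snd (h i)"] sub[of "fst (h i)" "snd (h i)"] hp[OF that]
    by (auto simp: l_def r_def)
  have disj: "disjoint_family_on (\<lambda>i. {l i<..<r i}) {..<card p}"
    unfolding disjoint_family_on_def
  proof (intro ballI impI)
    fix i j assume ij: "i \<in> {..<card p}" "j \<in> {..<card p}" "i \<noteq> j"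
    then have "h i \<noteq> h j" using h by (auto simp: bij_betw_def inj_on_def)
    moreover have "(fst (h i), snd (h i)) \<in> p" "(fst (h j), snd (h j)) \<in> p" using hp ij by auto
    ultimately have "interior (snd (h i)) \<inter> interior (snd (h j)) = {}"
      using tagged_partial_division_ofD(5)[OF p] by (metis prod.collapse)
    then show "{l i<..<r i} \<inter> {l j<..<r j} = {}" using lr ij by simp
  qed
  have "\<delta> > 0" using U(2) by (metis ennreal_eq_0_iff linorder_not_le not_less_zero)
  obtain d where d: "d \<ge> 0" "d < \<delta>" "emeasure lebesgue U = ennreal d"
    using U(2) \<open>\<delta> > 0\<close> by (cases "emeasure lebesgue U") (auto simp: ennreal_less_iff)
  have "(\<Sum>i<card p. r i - l i) \<le> d"
  proof (rule sum_length_disjoint_intervals_le[OF _ _ disj _ U(1)])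
    show "{l i<..<r i} \<subseteq> U" if "i \<in> {..<card p}" for i
      using lr[of i] that interior_subset[of "snd (h i)"] by auto
  qed (use lr d in auto)
  with d have "(\<Sum>i<card p. \<bar>f (r i) - f (l i)\<bar>) < e"
    by (intro \<delta> disj) (use lr in auto)
  also have "(\<Sum>i<card p. \<bar>f (r i) - f (l i)\<bar>) = (\<Sum>i<card p. (\<lambda>(x,K). \<bar>f (Sup K) - f (Inf K)\<bar>) (h i))"
    by (simp add: l_def r_def case_prod_beta)
  also have "\<dots> = (\<Sum>(x,K)\<in>p. \<bar>f (Sup K) - f (Inf K)\<bar>)"
    by (rule sum.reindex_bij_betw[OF h])
  finally show ?thesis .
qed

text \<open>Absolute continuity is exactly what makes a null set of bad points harmless for the gauge
  integral. At a point of the null set the gauge confines the interval to an open set \<open>U\<close> of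
  measure less than \<open>\<delta>\<close>, so all these intervals together contribute little increment; at every
  other point differentiability controls the interval as in the classical theorem.\<close>
theorem abs_continuous_fundamental_theorem:
  fixes f f' :: "real \<Rightarrow> real"
  assumes "a \<le> b" and ac: "abs_continuous_on a b f" and "negligible N"
    and der: "\<And>x. x \<in> {a<..<b} - N \<Longrightarrow> (f has_real_derivative f' x) (at x)"
  shows "(f' has_integral (f b - f a)) {a..b}"
proof (cases "a = b")
  case True
  then show ?thesis using has_integral_refl(2)[of f' b] by simp
next
  case False
  with \<open>a \<le> b\<close> have ab: "a < b" by simp
  define N' where "N' = N \<union> {a, b}"
  have neg: "negligible N'" using \<open>negligible N\<close> by (simp add: N'_def negligible_Un)
  define g where "g x = (if x \<in> N' then 0 else f' x)" for x
  have "(g has_integral (f b - f a)) {a..b}"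
    unfolding has_integral_factor_content_real
  proof (intro allI impI)
    fix e :: real assume e: "e > 0"
    then have "e * (b - a) / 2 > 0" using ab by simp
    then obtain \<delta> where \<delta>: "\<delta> > 0" "\<And>(n::nat) l r. \<lbrakk>\<forall>i<n. a \<le> l i \<and> l i \<le> r i \<and> r i \<le> b;
        disjoint_family_on (\<lambda>i. {l i<..<r i}) {..<n}; (\<Sum>i<n. r i - l i) < \<delta>\<rbrakk> \<Longrightarrow>
        (\<Sum>i<n. \<bar>f (r i) - f (l i)\<bar>) < e * (b - a) / 2"
      using ac unfolding abs_continuous_on_def by meson
    have N'0: "N' \<in> sets lebesgue" "emeasure lebesgue N' = 0"
      using neg by (auto simp: negligible_iff_null_sets)
    obtain U where U: "open U" "N' \<subseteq> U" "U - N' \<in> lmeasurable" "emeasure lebesgue (U - N') < ennreal \<delta>"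
      using sets_lebesgue_outer_open[OF N'0(1) \<delta>(1)] by metis
    have Us: "U \<in> sets lebesgue" using U(1) by auto
    have "emeasure lebesgue U \<le> emeasure lebesgue (U - N') + emeasure lebesgue N'"
    proof -
      have "U = (U - N') \<union> N'" using U by auto
      then show ?thesis using emeasure_subadditive[of "U - N'" lebesgue N'] N'0 Us by (metis sets.Diff)
    qed
    then have Um: "emeasure lebesgue U < ennreal \<delta>" using U(4) N'0 by simp
    have "\<forall>x. \<exists>d>0. x \<in> {a..b} - N' \<longrightarrow> (\<forall>y. norm (y-x) < d \<longrightarrow> norm (f y - f x - (y-x) * f' x) \<le> e/2 * norm (y-x))"
    proof
      fix x
      show "\<exists>d>0. x \<in> {a..b} - N' \<longrightarrow> (\<forall>y. norm (y-x) < d \<longrightarrow> norm (f y - f x - (y-x) * f' x) \<le> e/2 * norm (y-x))"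
      proof (cases "x \<in> {a..b} - N'")
        case True
        then have "(f has_derivative (\<lambda>h. f' x * h)) (at x)"
          using der[of x] by (auto simp: N'_def has_field_derivative_def)
        then show ?thesis using e unfolding has_derivative_at_alt
          by (metis half_gt_zero mult.commute)
      next
        case False then show ?thesis using zero_less_one by blast
      qed
    qed
    then obtain d where d: "\<And>x. 0 < d x"
      "\<And>x y. \<lbrakk>x \<in> {a..b} - N'; norm (y-x) < d x\<rbrakk> \<Longrightarrow> norm (f y - f x - (y-x) * f' x) \<le> e/2 * norm (y-x)"
      by metis
    define \<gamma> where "\<gamma> x = (if x \<in> N' then U else ball x (d x))" for x
    have gauge: "gauge \<gamma>" using U d(1) by (auto simp: gauge_def \<gamma>_def)
    have bound: "norm ((\<Sum>(x, k)\<in>p. measure lborel k *\<^sub>R g x) - (f b - f a)) \<le> e * measure lborel {a..b}"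
      if ptag: "p tagged_division_of {a..b}" and fine: "\<gamma> fine p" for p
    proof -
      have fin: "finite p" using ptag by auto
      have K: "x \<in> K \<and> Inf K \<le> Sup K \<and> K \<subseteq> {a..b} \<and> K = {Inf K..Sup K} \<and> K \<subseteq> \<gamma> x"
        if xK: "(x, K) \<in> p" for x K
      proof -
        from ptag xK obtain u v where "K = cbox u v" "x \<in> K" "K \<subseteq> {a..b}"
          using tagged_division_ofD by metis
        moreover have "K \<subseteq> \<gamma> x" using fine xK by (auto simp: fine_def)
        ultimately show ?thesis by auto
      qed
      have ba: "b - a = (\<Sum>(x,K)\<in>p. Sup K - Inf K)" "f b - f a = (\<Sum>(x,K)\<in>p. f(Sup K) - f(Inf K))"
        using additive_tagged_division_1[where f= "\<lambda>x. x"] additive_tagged_division_1[where f= f]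
              \<open>a \<le> b\<close> ptag by auto
      define p1 where "p1 = {(x,K)\<in>p. x \<in> N'}"
      have p1: "p1 \<subseteq> p" by (auto simp: p1_def)
      have p1tag: "p1 tagged_partial_division_of {a..b}"
        using ptag p1 tagged_division_of_def tagged_partial_division_subset by metis
      have A: "(\<Sum>(x,K)\<in>p1. \<bar>f (Sup K) - f (Inf K)\<bar>) < e * (b - a) / 2"
      proof (rule abs_continuous_small_on_tagged[where a = a and b = b and U = U and \<delta> = \<delta>])
        show "K \<subseteq> U" if "(x, K) \<in> p1" for x K
          using K[of x K] that by (auto simp: p1_def \<gamma>_def)
      qed (fact \<delta>(2) p1tag Us Um)+
      let ?t = "\<lambda>(x,K). measure lborel K *\<^sub>R g x - (f (Sup K) - f (Inf K))"
      have B: "norm (\<Sum>q\<in>p - p1. ?t q) \<le> (\<Sum>q\<in>p - p1. (\<lambda>(x,K). e/2 * (Sup K - Inf K)) q)"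
      proof (rule sum_norm_le, safe)
        fix x K assume xK: "(x, K) \<in> p" "(x, K) \<notin> p1"
        then have x: "x \<notin> N'" by (auto simp: p1_def)
        let ?u = "Inf K" and ?v = "Sup K"
        note K' = K[OF xK(1)]
        have "measure lborel K = ?v - ?u" using K' by (metis measure_lborel_Icc)
        moreover have "?u \<in> K" "?v \<in> K" "K \<subseteq> ball x (d x)" "x \<in> {a..b} - N'"
          "?u \<le> x" "x \<le> ?v"
          using x K' by (auto simp: \<gamma>_def)
        ultimately have *: "measure lborel K = ?v - ?u" "?u \<in> K" "?v \<in> K" "K \<subseteq> ball x (d x)"
          "x \<in> {a..b} - N'" "?u \<le> x" "x \<le> ?v" by auto
        have "norm (f ?u - f x - (?u-x) * f' x) \<le> e/2 * norm (?u-x)"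
          "norm (f ?v - f x - (?v-x) * f' x) \<le> e/2 * norm (?v-x)"
          by (intro d(2); use * in \<open>force simp: dist_real_def\<close>)+
        note bounds = this
        have eq: "(?v - ?u) * f' x - (f ?v - f ?u)
            = (f ?u - f x - (?u-x) * f' x) - (f ?v - f x - (?v-x) * f' x)"
          by (simp add: algebra_simps)
        have "norm ((?v - ?u) * f' x - (f ?v - f ?u)) \<le> e/2 * norm (?u-x) + e/2 * norm (?v-x)"
          unfolding eq by (rule order_trans[OF norm_triangle_ineq4 add_mono[OF bounds]])
        also have "\<dots> = e/2 * (?v - ?u)" using *(6,7) by (simp add: field_simps)
        finally show "norm (measure lborel K *\<^sub>R g x - (f ?v - f ?u)) \<le> e/2 * (?v - ?u)"
          using * x by (simp add: g_def)
      qed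
      also have "\<dots> \<le> (\<Sum>q\<in>p. (\<lambda>(x,K). e/2 * (Sup K - Inf K)) q)"
        by (rule sum_mono2) (use fin K e in \<open>auto simp: case_prod_beta\<close>)
      also have "\<dots> = e * (b - a) / 2"
        unfolding ba(1) by (simp add: sum_distrib_left case_prod_beta sum_divide_distrib)
      finally have B: "norm (\<Sum>q\<in>p - p1. ?t q) \<le> e * (b - a) / 2" .
      have C: "norm (\<Sum>q\<in>p1. ?t q) \<le> (\<Sum>(x,K)\<in>p1. \<bar>f (Sup K) - f (Inf K)\<bar>)"
        by (rule sum_norm_le) (auto simp: p1_def g_def)
      have "(\<Sum>(x, k)\<in>p. measure lborel k *\<^sub>R g x) - (f b - f a) = (\<Sum>q\<in>p. ?t q)"
        unfolding ba(2) by (simp add: sum_subtractf case_prod_beta)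
      also have "\<dots> = (\<Sum>q\<in>p - p1. ?t q) + (\<Sum>q\<in>p1. ?t q)"
        by (rule sum.subset_diff[OF p1 fin])
      finally have eq: "(\<Sum>(x, k)\<in>p. measure lborel k *\<^sub>R g x) - (f b - f a)
          = (\<Sum>q\<in>p - p1. ?t q) + (\<Sum>q\<in>p1. ?t q)" .
      have "norm ((\<Sum>(x, k)\<in>p. measure lborel k *\<^sub>R g x) - (f b - f a))
          \<le> e * (b - a) / 2 + e * (b - a) / 2"
        unfolding eq
        by (rule order_trans[OF norm_triangle_ineq add_mono[OF B order_trans[OF C less_imp_le[OF A]]]])
      then show ?thesis using ab by simp
    qed
    show "\<exists>d. gauge d \<and> (\<forall>p. p tagged_division_of {a..b} \<and> d fine p \<longrightarrow>
        norm ((\<Sum>(x, k)\<in>p. measure lborel k *\<^sub>R g x) - (f b - f a)) \<le> e * measure lborel {a..b})"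
      using gauge bound by (intro exI[of _ \<gamma>] conjI allI impI) (simp_all only:)
  qed
  then show ?thesis
    by (rule has_integral_spike[OF neg, rotated]) (auto simp: g_def)
qed

section \<open>Integrals on a bounded interval and integration by parts\<close>

lemma integrable_mult_square_integrable:
  fixes u v :: "'a \<Rightarrow> real"
  assumes [measurable]: "u \<in> borel_measurable M" "v \<in> borel_measurable M"
    and "integrable M (\<lambda>x. (u x)\<^sup>2)" "integrable M (\<lambda>x. (v x)\<^sup>2)"
  shows "integrable M (\<lambda>x. u x * v x)"
proof (rule Bochner_Integration.integrable_bound)
  show "integrable M (\<lambda>x. (u x)\<^sup>2 + (v x)\<^sup>2)" using assms by auto
  have "\<bar>a * b\<bar> \<le> a\<^sup>2 + b\<^sup>2" for a b :: real
    using zero_le_power2[of "a + b"] zero_le_power2[of "a - b"]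
    unfolding power2_sum power2_diff using zero_le_power2[of a] zero_le_power2[of b]
    by (simp add: abs_le_iff)
  then show "AE x in M. norm (u x * v x) \<le> norm ((u x)\<^sup>2 + (v x)\<^sup>2)"
    by (auto intro!: AE_I2 order_trans[OF _ abs_ge_self])
qed measurable

text \<open>The integrability hypothesis for every use of Fubini's theorem below: the kernel is the
  Green function, its derivative, or the indicator of \<open>r \<le> s\<close>.\<close>
lemma (in pair_sigma_finite) integrable_bounded_kernel:
  fixes K :: "'a \<Rightarrow> 'b \<Rightarrow> real"
  assumes [measurable]: "(\<lambda>(x, y). K x y) \<in> borel_measurable (M1 \<Otimes>\<^sub>M M2)"
    and bound: "AE x in M1. AE y in M2. \<bar>K x y\<bar> \<le> C"
    and u: "integrable M1 u" and w: "integrable M2 w"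
  shows "integrable (M1 \<Otimes>\<^sub>M M2) (\<lambda>(x, y). u x * (K x y * w y) :: real)"
proof (rule Fubini_integrable)
  have [measurable]: "u \<in> borel_measurable M1" "w \<in> borel_measurable M2" using u w by auto
  show "(\<lambda>(x, y). u x * (K x y * w y)) \<in> borel_measurable (M1 \<Otimes>\<^sub>M M2)" by measurable
  have le: "AE x in M1. AE y in M2. \<bar>K x y * w y\<bar> \<le> C * \<bar>w y\<bar>"
    using bound
  proof eventually_elim
    case (elim x)
    then show ?case by eventually_elim (simp add: abs_mult mult_right_mono)
  qed
  have int: "AE x in M1. integrable M2 (\<lambda>y. K x y * w y)"
    using le AE_space
  proof eventually_elim
    case (elim x)
    show ?case
    proof (rule Bochner_Integration.integrable_bound)
      show "integrable M2 (\<lambda>y. C * \<bar>w y\<bar>)" using w by auto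
      show "AE y in M2. norm (K x y * w y) \<le> norm (C * \<bar>w y\<bar>)"
        using elim(1) by eventually_elim (simp add: order_trans[OF _ abs_ge_self])
    qed (use elim in measurable)
  qed
  then show "AE x in M1. integrable M2 (\<lambda>y. case (x, y) of (x, y) \<Rightarrow> u x * (K x y * w y))"
    by eventually_elim simp
  show "integrable M1 (\<lambda>x. LINT y|M2. norm (case (x, y) of (x, y) \<Rightarrow> u x * (K x y * w y)))"
  proof (rule Bochner_Integration.integrable_bound)
    show "integrable M1 (\<lambda>x. (C * (LINT y|M2. \<bar>w y\<bar>)) * u x)"
      using u by auto
    show "AE x in M1. norm (LINT y|M2. norm (case (x, y) of (x, y) \<Rightarrow> u x * (K x y * w y)))
        \<le> norm (C * (LINT y|M2. \<bar>w y\<bar>) * u x)"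
      using le int
    proof eventually_elim
      case (elim x)
      have "(LINT y|M2. \<bar>K x y * w y\<bar>) \<le> (LINT y|M2. C * \<bar>w y\<bar>)"
        using elim w by (intro integral_mono_AE) auto
      then have "(LINT y|M2. \<bar>K x y * w y\<bar>) \<le> \<bar>C * (LINT y|M2. \<bar>w y\<bar>)\<bar>"
        by (simp add: order_trans[OF _ abs_ge_self])
      then have "\<bar>u x\<bar> * (LINT y|M2. \<bar>K x y * w y\<bar>) \<le> \<bar>u x\<bar> * \<bar>C * (LINT y|M2. \<bar>w y\<bar>)\<bar>"
        by (rule mult_left_mono) simp
      moreover have eq: "(LINT y|M2. norm (case (x, y) of (x, y) \<Rightarrow> u x * (K x y * w y)))
          = \<bar>u x\<bar> * (LINT y|M2. \<bar>K x y * w y\<bar>)"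
        unfolding integral_mult_right_zero[symmetric] by (simp add: abs_mult[of "u x"])
      moreover have "norm (\<bar>u x\<bar> * (LINT y|M2. \<bar>K x y * w y\<bar>)) = \<bar>u x\<bar> * (LINT y|M2. \<bar>K x y * w y\<bar>)"
        by simp
      moreover have "norm (C * (LINT y|M2. \<bar>w y\<bar>) * u x) = \<bar>u x\<bar> * \<bar>C * (LINT y|M2. \<bar>w y\<bar>)\<bar>"
        by (simp add: abs_mult)
      ultimately show ?case
        by (simp only:)
    qed
  qed measurable
qed

text \<open>Lebesgue measure on \<open>[0,T]\<close>, realised as a density rather than a restriction, so that its
  measurable functions are the Borel functions on the whole line and products of it can be
  treated by the usual measurability rules.\<close>
definition segment :: "real \<Rightarrow> real measure" where
  "segment T = density lborel (indicator {0..T})"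

lemma sets_segment [simp, measurable_cong]: "sets (segment T) = sets borel"
  and space_segment [simp]: "space (segment T) = UNIV"
  by (simp_all add: segment_def)

interpretation segment: finite_measure "segment T"
  by standard (simp add: segment_def emeasure_density nn_integral_indicator emeasure_lborel_Icc_eq)

interpretation segment_pair: pair_sigma_finite "segment T" "segment T" ..

lemma AE_segment: "(AE s in segment T. P s) \<longleftrightarrow> (AE s in lborel. s \<in> {0..T} \<longrightarrow> P s)"
  unfolding segment_def by (subst AE_density) (auto intro!: AE_cong simp: indicator_def)

lemma AE_segment_mem: "AE s in segment T. s \<in> {0..T}"
  by (simp add: AE_segment)

lemma AE_segment_neq: "AE s in segment T. s \<noteq> t"
  using AE_lborel_singleton[of t] by (auto simp: AE_segment)

lemma nn_integral_segment:
  "f \<in> borel_measurable borel \<Longrightarrow> (\<integral>\<^sup>+s. f s \<partial>segment T) = (\<integral>\<^sup>+s. f s * indicator {0..T} s \<partial>lborel)"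
  unfolding segment_def by (subst nn_integral_density) (auto simp: mult.commute)

lemma set_integrable_segment:
  fixes f :: "real \<Rightarrow> real"
  assumes "f \<in> borel_measurable borel"
  shows "set_integrable lborel {0..T} f \<longleftrightarrow> integrable (segment T) f"
  using integrable_density[of f lborel "indicator {0..T}"] assms
  by (simp add: segment_def set_integrable_def ennreal_indicator)

lemma integral_segment:
  fixes f :: "real \<Rightarrow> real"
  assumes "f \<in> borel_measurable borel"
  shows "(\<integral>s. f s \<partial>segment T) = (LINT s:{0..T}|lborel. f s)"
  using integral_density[of f lborel "indicator {0..T}"] assms
  by (simp add: segment_def set_lebesgue_integral_def ennreal_indicator)

lemma integrable_segment_bounded:
  fixes f :: "real \<Rightarrow> real"
  assumes "f \<in> borel_measurable borel" "\<And>s. s \<in> {0..T} \<Longrightarrow> \<bar>f s\<bar> \<le> B"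
  shows "integrable (segment T) f"
proof (rule segment.integrable_const_bound[of _ B])
  show "AE s in segment T. norm (f s) \<le> B"
    using AE_segment_mem[of T] by eventually_elim (use assms in auto)
qed (use assms in simp)

lemma integrable_segment_square_bounded:
  fixes f :: "real \<Rightarrow> real"
  assumes "f \<in> borel_measurable borel" "\<And>s. s \<in> {0..T} \<Longrightarrow> \<bar>f s\<bar> \<le> B"
  shows "integrable (segment T) (\<lambda>s. (f s)\<^sup>2)"
proof (rule integrable_segment_bounded)
  show "\<bar>(f s)\<^sup>2\<bar> \<le> B\<^sup>2" if "s \<in> {0..T}" for s
    using power_mono[OF assms(2)[OF that] abs_ge_zero, of 2] by simp
qed (use assms(1) in measurable)

definition primitive :: "real \<Rightarrow> (real \<Rightarrow> real) \<Rightarrow> real \<Rightarrow> real" where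
  "primitive T v s = (\<integral>r. (if r \<le> s then v r else 0) \<partial>segment T)"

lemma measurable_primitive [measurable]:
  assumes [measurable]: "v \<in> borel_measurable borel"
  shows "primitive T v \<in> borel_measurable borel"
  unfolding primitive_def by measurable

lemma integrable_truncate:
  fixes v :: "real \<Rightarrow> real"
  assumes "integrable (segment T) v"
  shows "integrable (segment T) (\<lambda>r. if r \<le> s then v r else 0)"
  by (rule Bochner_Integration.integrable_bound[OF assms])
    (use borel_measurable_integrable[OF assms] in \<open>auto intro!: AE_I2\<close>)

lemma abs_primitive_le:
  assumes "integrable (segment T) v"
  shows "\<bar>primitive T v s\<bar> \<le> (\<integral>r. \<bar>v r\<bar> \<partial>segment T)"
proof -
  have "\<bar>primitive T v s\<bar> \<le> (\<integral>r. \<bar>if r \<le> s then v r else 0\<bar> \<partial>segment T)"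
    unfolding primitive_def by (rule integral_abs_bound)
  also have "\<dots> \<le> (\<integral>r. \<bar>v r\<bar> \<partial>segment T)"
    by (rule integral_mono) (use integrable_truncate[OF assms] assms in auto)
  finally show ?thesis .
qed

lemma has_integral_primitive:
  assumes [measurable]: "v \<in> borel_measurable borel" and v: "integrable (segment T) v"
    and s: "0 \<le> s" "s \<le> T"
  shows "(v has_integral primitive T v s) {0..s}"
proof -
  let ?v = "\<lambda>r. if r \<le> s then v r else 0"
  have "set_integrable lborel {0..T} ?v"
    using integrable_truncate[OF v] by (simp add: set_integrable_segment)
  then have "(?v has_integral primitive T v s) {0..T}"
    unfolding primitive_def using set_borel_integral_eq_integral[of "{0..T}" ?v]
    by (subst integral_segment) (auto simp: has_integral_iff)
  also have "?this \<longleftrightarrow> ((\<lambda>r. if r \<in> {0..s} then v r else 0) has_integral primitive T v s) {0..T}"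
    by (rule has_integral_cong) auto
  also have "\<dots> \<longleftrightarrow> (v has_integral primitive T v s) {0..s}"
    using s by (intro has_integral_restrict) auto
  finally show ?thesis .
qed

lemma primitive_eqI:
  assumes "v \<in> borel_measurable borel" "integrable (segment T) v" "0 \<le> s" "s \<le> T"
    "(v has_integral I) {0..s}"
  shows "primitive T v s = I"
  using has_integral_primitive[OF assms(1-4)] assms(5) by (rule has_integral_unique)

lemma primitive_end:
  assumes [measurable]: "v \<in> borel_measurable borel"
  shows "primitive T v T = (\<integral>r. v r \<partial>segment T)"
  unfolding primitive_def
proof (rule integral_cong_AE)
  show "AE r in segment T. (if r \<le> T then v r else 0) = v r"
    using AE_segment_mem[of T] by eventually_elim auto
qed measurable

lemma continuous_on_primitive:
  assumes "v \<in> borel_measurable borel" "integrable (segment T) v"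
  shows "continuous_on {0..T} (primitive T v)"
proof (cases "0 \<le> T")
  case True
  have "v integrable_on {0..T}" using has_integral_primitive[OF assms True] by auto
  then have "continuous_on {0..T} (\<lambda>s. integral {0..s} v)" by (rule indefinite_integral_continuous_1)
  then show ?thesis
    by (rule continuous_on_eq) (use has_integral_primitive[OF assms] in \<open>auto intro: integral_unique\<close>)
qed auto

lemma primitive_diff:
  assumes "integrable (segment T) u" "integrable (segment T) v"
  shows "primitive T (\<lambda>r. u r - v r) s = primitive T u s - primitive T v s"
  unfolding primitive_def
  by (subst Bochner_Integration.integral_diff[symmetric])
    (use assms in \<open>auto intro!: integrable_truncate Bochner_Integration.integral_cong\<close>)

text \<open>Integration of \<open>\<integral> A(r,t) w(t) dt\<close> in \<open>r\<close> acts on the kernel alone.\<close>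
lemma primitive_kernel:
  fixes A :: "real \<Rightarrow> real \<Rightarrow> real"
  assumes [measurable]: "(\<lambda>(r, t). A r t) \<in> borel_measurable (borel \<Otimes>\<^sub>M borel)"
    and bound: "\<And>r t. \<lbrakk>r \<in> {0..T}; t \<in> {0..T}\<rbrakk> \<Longrightarrow> \<bar>A r t\<bar> \<le> C" and w: "integrable (segment T) w"
  shows "primitive T (\<lambda>r. \<integral>t. A r t * w t \<partial>segment T) s = (\<integral>t. primitive T (\<lambda>r. A r t) s * w t \<partial>segment T)"
proof -
  let ?L = "segment T" and ?A = "\<lambda>r t. if r \<le> s then A r t else 0"
  have "AE r in ?L. AE t in ?L. \<bar>?A r t\<bar> \<le> \<bar>C\<bar>"
    using AE_segment_mem[of T]
  proof eventually_elim
    case (elim r)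
    show ?case using AE_segment_mem[of T] by eventually_elim (use bound[OF elim] in force)
  qed
  then have int: "integrable (?L \<Otimes>\<^sub>M ?L) (\<lambda>(r, t). 1 * (?A r t * w t))"
    by (intro segment_pair.integrable_bounded_kernel[of _ _ "\<bar>C\<bar>"] w) auto
  have "primitive T (\<lambda>r. \<integral>t. A r t * w t \<partial>?L) s = (\<integral>r. \<integral>t. 1 * (?A r t * w t) \<partial>?L \<partial>?L)"
    unfolding primitive_def by (intro Bochner_Integration.integral_cong) auto
  also have "\<dots> = (\<integral>t. \<integral>r. 1 * (?A r t * w t) \<partial>?L \<partial>?L)"
    using segment_pair.Fubini_integral[OF int] by simp
  also have "\<dots> = (\<integral>t. primitive T (\<lambda>r. A r t) s * w t \<partial>?L)"
    unfolding primitive_def by simp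
  finally show ?thesis .
qed

text \<open>Fubini's theorem on the triangle \<open>r \<le> s\<close>; the boundary terms vanish because the primitive of \<open>u\<close> is zero at both ends.\<close>
lemma primitive_by_parts:
  assumes [measurable]: "u \<in> borel_measurable borel" "v \<in> borel_measurable borel"
    and u: "integrable (segment T) u" and v: "integrable (segment T) v"
    and zero: "(\<integral>s. u s \<partial>segment T) = 0"
  shows "(\<integral>s. u s * (c + primitive T v s) \<partial>segment T) = - (\<integral>s. primitive T u s * v s \<partial>segment T)"
proof -
  let ?L = "segment T" and ?K = "\<lambda>s r. if r \<le> s then 1 else 0 :: real"
  have int: "integrable (?L \<Otimes>\<^sub>M ?L) (\<lambda>(s, r). u s * (?K s r * v r))"
    by (intro segment_pair.integrable_bounded_kernel[of _ _ 1] u v) auto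
  have eq: "u s * primitive T v s = (\<integral>r. u s * (?K s r * v r) \<partial>?L)" for s
    unfolding primitive_def by (subst integral_mult_right_zero[symmetric]) (auto intro!: Bochner_Integration.integral_cong)
  have intv: "integrable ?L (\<lambda>s. u s * primitive T v s)"
    unfolding eq using segment_pair.integrable_fst'[OF int] by simp
  have "(\<integral>s. u s * (c + primitive T v s) \<partial>?L) = (\<integral>s. u s * c + u s * primitive T v s \<partial>?L)"
    by (simp add: algebra_simps)
  also have "\<dots> = (\<integral>s. u s * c \<partial>?L) + (\<integral>s. u s * primitive T v s \<partial>?L)"
    using u intv by (intro Bochner_Integration.integral_add) auto
  also have "\<dots> = (\<integral>s. u s * primitive T v s \<partial>?L)"
    using zero by simp
  also have "\<dots> = (\<integral>r. \<integral>s. u s * (?K s r * v r) \<partial>?L \<partial>?L)"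
    unfolding eq using segment_pair.Fubini_integral[OF int] by simp
  also have "\<dots> = (\<integral>r. - (primitive T u r * v r) \<partial>?L)"
  proof (rule Bochner_Integration.integral_cong[OF refl])
    fix r
    \<comment> \<open>The indicators of \<open>r \<le> s\<close> and \<open>s \<le> r\<close> are complementary off the null set \<open>s = r\<close>.\<close>
    have "(\<integral>s. u s * (?K s r * v r) \<partial>?L) = (\<integral>s. (u s - (if s \<le> r then u s else 0)) * v r \<partial>?L)"
    proof (rule integral_cong_AE)
      show "AE s in ?L. u s * (?K s r * v r) = (u s - (if s \<le> r then u s else 0)) * v r"
        using AE_segment_neq[of r T] by eventually_elim auto
    qed measurable
    also have "\<dots> = (\<integral>s. (u s - (if s \<le> r then u s else 0)) \<partial>?L) * v r"
      by simp
    also have "(\<integral>s. (u s - (if s \<le> r then u s else 0)) \<partial>?L) = - primitive T u r"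
      using u integrable_truncate[OF u, of r] zero by (simp add: primitive_def)
    finally show "(\<integral>s. u s * (?K s r * v r) \<partial>?L) = - (primitive T u r * v r)" by simp
  qed
  finally show ?thesis by simp
qed

section \<open>The Green function of the Neumann problem\<close>

text \<open>The Green function of \<open>f - f''\<close> on \<open>[0,T]\<close> with Neumann boundary conditions, in the form given
  by variation of constants: the first summand solves the homogeneous equation with zero slope
  at \<open>0\<close>, the second is the response to a unit impulse at \<open>t\<close>. This form is convenient for
  differentiation and integration in \<open>s\<close>; symmetry, positivity and the asymptotic behaviour are
  read off from \<open>neumann_kernel_alt\<close>.\<close>
definition neumann_kernel :: "real \<Rightarrow> real \<Rightarrow> real \<Rightarrow> real" where
  "neumann_kernel T s t = cosh (T - t) * cosh s / sinh T - (if t \<le> s then sinh (s - t) else 0)"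

definition neumann_kernel_deriv :: "real \<Rightarrow> real \<Rightarrow> real \<Rightarrow> real" where
  "neumann_kernel_deriv T s t = cosh (T - t) * sinh s / sinh T - (if t \<le> s then cosh (s - t) else 0)"

lemma borel_measurable_sinh_cosh [measurable]:
  "sinh \<in> borel_measurable (borel :: real measure)" "cosh \<in> borel_measurable (borel :: real measure)"
  by (auto intro!: borel_measurable_continuous_onI continuous_intros)

lemma measurable_neumann_kernel [measurable (raw)]:
  assumes [measurable]: "f \<in> borel_measurable N" "g \<in> borel_measurable N"
  shows "(\<lambda>x. neumann_kernel T (f x) (g x)) \<in> borel_measurable N"
    "(\<lambda>x. neumann_kernel_deriv T (f x) (g x)) \<in> borel_measurable N"
  unfolding neumann_kernel_def neumann_kernel_deriv_def by measurable

text \<open>For the impulse response, where \<open>F\<close> is \<open>sinh\<close> or \<open>cosh\<close>.\<close>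
lemma has_integral_truncated_shift:
  fixes F f :: "real \<Rightarrow> real"
  assumes der: "\<And>x. (F has_real_derivative f x) (at x)" and "0 \<le> t"
  shows "((\<lambda>r. if t \<le> r then f (r - t) else 0) has_integral (if t \<le> s then F (s - t) - F 0 else 0)) {0..s}"
proof (cases "t \<le> s")
  case True
  have der': "((\<lambda>r. F (r - t)) has_real_derivative f (r - t)) (at r)" for r
  proof -
    have "((\<lambda>r. r - t) has_real_derivative 1) (at r)" by (auto intro!: derivative_eq_intros)
    from DERIV_chain2[OF der this] show ?thesis by simp
  qed
  have "((\<lambda>r. f (r - t)) has_integral (F (s - t) - F (t - t))) {t..s}"
    by (rule fundamental_theorem_of_calculus[OF True])
      (rule has_vector_derivative_at_within, rule der'[unfolded has_real_derivative_iff_has_vector_derivative])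
  then have "((\<lambda>r. if r \<in> {t..s} then f (r - t) else 0) has_integral (F (s - t) - F 0)) {0..s}"
    using \<open>0 \<le> t\<close> by (subst has_integral_restrict) auto
  then have "((\<lambda>r. if t \<le> r then f (r - t) else 0) has_integral (F (s - t) - F 0)) {0..s}"
    by (rule has_integral_eq[rotated]) auto
  then show ?thesis
    using True by (simp only: if_True)
next
  case False
  then show ?thesis by (auto intro!: has_integral_is_0)
qed

lemma has_integral_neumann_kernel_deriv:
  assumes "0 \<le> t" "0 \<le> s" "0 < T"
  shows "((\<lambda>r. neumann_kernel_deriv T r t) has_integral (neumann_kernel T s t - neumann_kernel T 0 t)) {0..s}"
proof -
  have "((\<lambda>r. cosh (T - t) * sinh r / sinh T) has_integral
      (cosh (T - t) * cosh s / sinh T - cosh (T - t) * cosh 0 / sinh T)) {0..s}"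
    by (rule fundamental_theorem_of_calculus[OF assms(2)])
      (use \<open>0 < T\<close> in \<open>auto intro!: derivative_eq_intros simp flip: has_real_derivative_iff_has_vector_derivative\<close>)
  moreover have "((\<lambda>r. if t \<le> r then cosh (r - t) else 0) has_integral
      (if t \<le> s then sinh (s - t) - sinh 0 else 0)) {0..s}"
    by (rule has_integral_truncated_shift[OF _ assms(1)]) (auto intro!: derivative_eq_intros)
  ultimately have "((\<lambda>r. neumann_kernel_deriv T r t) has_integral
      (cosh (T - t) * cosh s / sinh T - cosh (T - t) * cosh 0 / sinh T)
        - (if t \<le> s then sinh (s - t) - sinh 0 else 0)) {0..s}"
    unfolding neumann_kernel_deriv_def by (rule has_integral_diff)
  then show ?thesis
    by (rule has_integral_eq_rhs) (use assms(1) in \<open>simp add: neumann_kernel_def\<close>)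
qed

text \<open>The second derivative of the kernel in \<open>s\<close> is the kernel minus a unit mass at \<open>t\<close>,
  stated in integrated form; the jump of the derivative appears as the indicator of \<open>t \<le> s\<close>.\<close>
lemma has_integral_neumann_kernel:
  assumes "0 \<le> t" "0 \<le> s" "0 < T"
  shows "((\<lambda>r. neumann_kernel T r t) has_integral
      (neumann_kernel_deriv T s t + (if t \<le> s then 1 else 0))) {0..s}"
proof -
  have "((\<lambda>r. cosh (T - t) * cosh r / sinh T) has_integral
      (cosh (T - t) * sinh s / sinh T - cosh (T - t) * sinh 0 / sinh T)) {0..s}"
    by (rule fundamental_theorem_of_calculus[OF assms(2)])
      (use \<open>0 < T\<close> in \<open>auto intro!: derivative_eq_intros simp flip: has_real_derivative_iff_has_vector_derivative\<close>)
  moreover have "((\<lambda>r. if t \<le> r then sinh (r - t) else 0) has_integral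
      (if t \<le> s then cosh (s - t) - cosh 0 else 0)) {0..s}"
    by (rule has_integral_truncated_shift[OF _ assms(1)]) (auto intro!: derivative_eq_intros)
  ultimately have "((\<lambda>r. neumann_kernel T r t) has_integral
      (cosh (T - t) * sinh s / sinh T - cosh (T - t) * sinh 0 / sinh T)
        - (if t \<le> s then cosh (s - t) - cosh 0 else 0)) {0..s}"
    unfolding neumann_kernel_def by (rule has_integral_diff)
  then show ?thesis
    by (rule has_integral_eq_rhs) (simp add: neumann_kernel_deriv_def)
qed

text \<open>By the addition formulas the kernel is the even function \<open>cosh (T - |x|)\<close> of the difference
  plus a term concentrated near the two endpoints, which disappears in the limit.\<close>
lemma neumann_kernel_alt:
  assumes "0 < T"
  shows "neumann_kernel T s t = (cosh (T - \<bar>s - t\<bar>) + cosh (T - s - t)) / (2 * sinh T)"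
proof -
  have prod: "cosh x * cosh y = (cosh (x - y) + cosh (x + y)) / 2" for x y :: real
    by (simp add: cosh_add cosh_diff)
  have "cosh (T - t) * cosh s - sinh T * sinh (s - t) = cosh (T - s) * cosh t"
    by (simp add: cosh_diff sinh_diff algebra_simps)
  moreover have "sinh T \<noteq> 0" using assms by simp
  ultimately have "neumann_kernel T s t
      = (if t \<le> s then cosh (T - s) * cosh t else cosh (T - t) * cosh s) / sinh T"
    by (simp add: neumann_kernel_def diff_divide_distrib[symmetric] divide_diff_eq_iff mult.commute)
  also have "\<dots> = (cosh (T - \<bar>s - t\<bar>) + cosh (T - s - t)) / (2 * sinh T)"
    unfolding prod by (simp add: algebra_simps)
  finally show ?thesis .
qed

lemma neumann_kernel_commute: "0 < T \<Longrightarrow> neumann_kernel T s t = neumann_kernel T t s"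
  by (simp add: neumann_kernel_alt abs_minus_commute algebra_simps)

lemma neumann_kernel_nonneg: "0 < T \<Longrightarrow> 0 \<le> neumann_kernel T s t"
  by (simp add: neumann_kernel_alt add_nonneg_nonneg)

lemma cosh_real_mono_abs: "\<bar>x\<bar> \<le> \<bar>y\<bar> \<Longrightarrow> cosh x \<le> cosh y" for x y :: real
  by (metis abs_ge_zero cosh_real_abs cosh_real_nonneg_le_iff)

lemma neumann_kernel_le:
  assumes "0 < T" "s \<in> {0..T}" "t \<in> {0..T}"
  shows "neumann_kernel T s t \<le> cosh (T - \<bar>s - t\<bar>) / sinh T"
proof -
  have "cosh (T - s - t) \<le> cosh (T - \<bar>s - t\<bar>)"
    by (rule cosh_real_mono_abs) (use assms in \<open>auto simp: abs_if\<close>)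
  then show ?thesis using assms by (simp add: neumann_kernel_alt field_simps)
qed

lemma neumann_kernel_bounded:
  assumes "0 < T" "s \<in> {0..T}" "t \<in> {0..T}"
  shows "\<bar>neumann_kernel T s t\<bar> \<le> cosh T / sinh T"
proof -
  have "cosh (T - \<bar>s - t\<bar>) \<le> cosh T"
    by (rule cosh_real_mono_abs) (use assms in \<open>auto simp: abs_if\<close>)
  then have "cosh (T - \<bar>s - t\<bar>) / sinh T \<le> cosh T / sinh T"
    using assms by (intro divide_right_mono) auto
  then show ?thesis
    using neumann_kernel_le[OF assms] neumann_kernel_nonneg[OF assms(1), of s t] by simp
qed

lemma neumann_kernel_deriv_bounded:
  assumes "0 < T" "s \<in> {0..T}" "t \<in> {0..T}"
  shows "\<bar>neumann_kernel_deriv T s t\<bar> \<le> 2 * cosh T"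
proof -
  have 1: "cosh (T - t) \<le> cosh T" "cosh (s - t) \<le> cosh T"
    by (rule cosh_real_mono_abs; use assms in \<open>auto simp: abs_if\<close>)+
  have "0 \<le> sinh s" "sinh s \<le> sinh T" "0 < sinh T" using assms by auto
  then have "\<bar>cosh (T - t) * (sinh s / sinh T)\<bar> \<le> cosh T * 1"
    unfolding abs_mult using 1 by (intro mult_mono) (auto simp: field_simps)
  moreover have "\<bar>if t \<le> s then cosh (s - t) else 0\<bar> \<le> cosh T" using 1 by auto
  moreover have "neumann_kernel_deriv T s t
      = cosh (T - t) * (sinh s / sinh T) - (if t \<le> s then cosh (s - t) else 0)"
    by (simp add: neumann_kernel_deriv_def)
  ultimately show ?thesis
    using abs_triangle_ineq4[of "cosh (T - t) * (sinh s / sinh T)" "if t \<le> s then cosh (s - t) else 0"]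
    by linarith
qed

lemma primitive_neumann_kernel_deriv:
  assumes "0 < T" "s \<in> {0..T}" "t \<in> {0..T}"
  shows "primitive T (\<lambda>r. neumann_kernel_deriv T r t) s = neumann_kernel T s t - neumann_kernel T 0 t"
proof (rule primitive_eqI)
  show "integrable (segment T) (\<lambda>r. neumann_kernel_deriv T r t)"
    by (rule integrable_segment_bounded) (measurable, rule neumann_kernel_deriv_bounded[OF assms(1) _ assms(3)])
  show "((\<lambda>r. neumann_kernel_deriv T r t) has_integral
      neumann_kernel T s t - neumann_kernel T 0 t) {0..s}"
    by (rule has_integral_neumann_kernel_deriv) (use assms in auto)
  show "0 \<le> s" "s \<le> T" using assms by auto
qed measurable

lemma primitive_neumann_kernel:
  assumes "0 < T" "s \<in> {0..T}" "t \<in> {0..T}"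
  shows "primitive T (\<lambda>r. neumann_kernel T r t) s = neumann_kernel_deriv T s t + (if t \<le> s then 1 else 0)"
proof (rule primitive_eqI)
  show "integrable (segment T) (\<lambda>r. neumann_kernel T r t)"
    by (rule integrable_segment_bounded) (measurable, rule neumann_kernel_bounded[OF assms(1) _ assms(3)])
  show "((\<lambda>r. neumann_kernel T r t) has_integral
      neumann_kernel_deriv T s t + (if t \<le> s then 1 else 0)) {0..s}"
    by (rule has_integral_neumann_kernel) (use assms in auto)
  show "0 \<le> s" "s \<le> T" using assms by auto
qed measurable

lemma neumann_kernel_deriv_end:
  assumes "0 < T" "t \<in> {0..T}"
  shows "neumann_kernel_deriv T T t = 0"
  using assms by (simp add: neumann_kernel_deriv_def)

text \<open>The constant function \<open>1\<close> solves the Neumann problem with right-hand side \<open>1\<close>.\<close>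
lemma integral_neumann_kernel:
  assumes "0 < T" "s \<in> {0..T}"
  shows "(\<integral>t. neumann_kernel T s t \<partial>segment T) = 1"
proof -
  have "(\<integral>t. neumann_kernel T s t \<partial>segment T) = primitive T (\<lambda>t. neumann_kernel T t s) T"
    using neumann_kernel_commute[OF assms(1)] by (simp add: primitive_end)
  also have "\<dots> = 1"
    using assms by (subst primitive_neumann_kernel) (auto simp: neumann_kernel_deriv_end)
  finally show ?thesis .
qed

lemma integrable_segment_mult_bounded:
  fixes A w :: "real \<Rightarrow> real"
  assumes [measurable]: "A \<in> borel_measurable borel" and w: "integrable (segment T) w"
    and bound: "\<And>t. t \<in> {0..T} \<Longrightarrow> \<bar>A t\<bar> \<le> C"
  shows "integrable (segment T) (\<lambda>t. A t * w t)"
proof (rule Bochner_Integration.integrable_bound)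
  show "integrable (segment T) (\<lambda>t. C * w t)" using w by simp
  show "AE t in segment T. norm (A t * w t) \<le> norm (C * w t)"
    using AE_segment_mem[of T]
  proof eventually_elim
    case (elim t)
    from bound[OF elim] have "\<bar>A t\<bar> \<le> \<bar>C\<bar>" by simp
    then show ?case by (simp add: abs_mult mult_right_mono)
  qed
qed (use w in \<open>measurable\<close>)

text \<open>The minimizer for the path \<open>w\<close>.\<close>
definition smoothing :: "real \<Rightarrow> (real \<Rightarrow> real) \<Rightarrow> real \<Rightarrow> real" where
  "smoothing T w s = (\<integral>t. neumann_kernel T s t * w t \<partial>segment T)"

definition smoothing_deriv :: "real \<Rightarrow> (real \<Rightarrow> real) \<Rightarrow> real \<Rightarrow> real" where
  "smoothing_deriv T w s = (\<integral>t. neumann_kernel_deriv T s t * w t \<partial>segment T)"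

lemma measurable_smoothing [measurable]:
  assumes [measurable]: "w \<in> borel_measurable borel"
  shows "smoothing T w \<in> borel_measurable borel" "smoothing_deriv T w \<in> borel_measurable borel"
  unfolding smoothing_def smoothing_deriv_def by measurable

lemma integral_bounded_kernel_le:
  fixes A w :: "real \<Rightarrow> real"
  assumes "integrable (segment T) w" "\<And>t. t \<in> {0..T} \<Longrightarrow> \<bar>A t\<bar> \<le> C" "A \<in> borel_measurable borel"
  shows "\<bar>\<integral>t. A t * w t \<partial>segment T\<bar> \<le> C * (\<integral>t. \<bar>w t\<bar> \<partial>segment T)"
proof -
  have "\<bar>\<integral>t. A t * w t \<partial>segment T\<bar> \<le> (\<integral>t. \<bar>A t * w t\<bar> \<partial>segment T)" by (rule integral_abs_bound)
  also have "\<dots> \<le> (\<integral>t. C * \<bar>w t\<bar> \<partial>segment T)"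
  proof (rule integral_mono_AE)
    show "AE t in segment T. \<bar>A t * w t\<bar> \<le> C * \<bar>w t\<bar>"
      using AE_segment_mem[of T] by eventually_elim (use assms in \<open>auto simp: abs_mult intro!: mult_right_mono\<close>)
  qed (use assms integrable_segment_mult_bounded[OF assms(3,1,2)] in auto)
  finally show ?thesis by simp
qed

context
  fixes T :: real and w :: "real \<Rightarrow> real"
  assumes T: "0 < T" and w [measurable]: "w \<in> borel_measurable borel"
    and int_w: "integrable (segment T) w"
begin

lemma smoothing_bounded:
  "s \<in> {0..T} \<Longrightarrow> \<bar>smoothing T w s\<bar> \<le> cosh T / sinh T * (\<integral>t. \<bar>w t\<bar> \<partial>segment T)"
  unfolding smoothing_def
  by (rule integral_bounded_kernel_le[OF int_w]) (use neumann_kernel_bounded[OF T] in auto)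

lemma smoothing_deriv_bounded:
  "s \<in> {0..T} \<Longrightarrow> \<bar>smoothing_deriv T w s\<bar> \<le> 2 * cosh T * (\<integral>t. \<bar>w t\<bar> \<partial>segment T)"
  unfolding smoothing_deriv_def
  by (rule integral_bounded_kernel_le[OF int_w]) (use neumann_kernel_deriv_bounded[OF T] in auto)

lemma integrable_smoothing:
  "integrable (segment T) (smoothing T w)" "integrable (segment T) (smoothing_deriv T w)"
  by (rule integrable_segment_bounded[OF _ smoothing_bounded], simp_all)
    (rule integrable_segment_bounded[OF _ smoothing_deriv_bounded], simp_all)

lemma integrable_kernel_mult:
  assumes "s \<in> {0..T}"
  shows "integrable (segment T) (\<lambda>t. neumann_kernel T s t * w t)"
    "integrable (segment T) (\<lambda>t. neumann_kernel_deriv T s t * w t)"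
  by (rule integrable_segment_mult_bounded[OF _ int_w];
      use neumann_kernel_bounded[OF T assms] neumann_kernel_deriv_bounded[OF T assms] in auto)+

lemma smoothing_eq_primitive:
  assumes s: "s \<in> {0..T}"
  shows "smoothing T w s = smoothing T w 0 + primitive T (smoothing_deriv T w) s"
proof -
  have "primitive T (smoothing_deriv T w) s
      = (\<integral>t. primitive T (\<lambda>r. neumann_kernel_deriv T r t) s * w t \<partial>segment T)"
    unfolding smoothing_deriv_def
    by (rule primitive_kernel[OF _ _ int_w]) (use neumann_kernel_deriv_bounded[OF T] in auto)
  also have "\<dots> = (\<integral>t. neumann_kernel T s t * w t - neumann_kernel T 0 t * w t \<partial>segment T)"
  proof (rule integral_cong_AE)
    show "AE t in segment T. primitive T (\<lambda>r. neumann_kernel_deriv T r t) s * w t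
        = neumann_kernel T s t * w t - neumann_kernel T 0 t * w t"
      using AE_segment_mem[of T]
      by eventually_elim (subst primitive_neumann_kernel_deriv[OF T s], simp_all add: algebra_simps)
  qed (unfold primitive_def, measurable)
  also have "\<dots> = smoothing T w s - smoothing T w 0"
    unfolding smoothing_def using T s
    by (intro Bochner_Integration.integral_diff integrable_kernel_mult) auto
  finally show ?thesis by simp
qed

text \<open>The Euler-Lagrange equation \<open>f'' = f - w\<close> with \<open>f'(0) = 0\<close>, once integrated.\<close>
lemma smoothing_deriv_eq_primitive:
  assumes s: "s \<in> {0..T}"
  shows "smoothing_deriv T w s = primitive T (\<lambda>r. smoothing T w r - w r) s"
proof -
  have "primitive T (smoothing T w) s
      = (\<integral>t. primitive T (\<lambda>r. neumann_kernel T r t) s * w t \<partial>segment T)"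
    unfolding smoothing_def
    by (rule primitive_kernel[OF _ _ int_w]) (use neumann_kernel_bounded[OF T] in auto)
  also have "\<dots> = (\<integral>t. neumann_kernel_deriv T s t * w t + (if t \<le> s then w t else 0) \<partial>segment T)"
  proof (rule integral_cong_AE)
    show "AE t in segment T. primitive T (\<lambda>r. neumann_kernel T r t) s * w t
        = neumann_kernel_deriv T s t * w t + (if t \<le> s then w t else 0)"
      using AE_segment_mem[of T]
      by eventually_elim (use primitive_neumann_kernel[OF T s] in \<open>auto simp: algebra_simps\<close>)
  qed (unfold primitive_def, measurable)
  also have "\<dots> = smoothing_deriv T w s + primitive T w s"
    unfolding smoothing_deriv_def primitive_def using T s
    by (intro Bochner_Integration.integral_add integrable_kernel_mult integrable_truncate int_w) auto
  finally show ?thesis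
    using primitive_diff[OF integrable_smoothing(1) int_w] by simp
qed

text \<open>The other boundary condition \<open>f'(T) = 0\<close>.\<close>
lemma integral_smoothing_minus: "(\<integral>s. smoothing T w s - w s \<partial>segment T) = 0"
proof -
  have "smoothing_deriv T w T = (\<integral>t. 0 \<partial>segment T)"
    unfolding smoothing_deriv_def
  proof (rule integral_cong_AE)
    show "AE t in segment T. neumann_kernel_deriv T T t * w t = 0"
      using AE_segment_mem[of T] by eventually_elim (use neumann_kernel_deriv_end[OF T] in auto)
  qed measurable
  then show ?thesis
    using smoothing_deriv_eq_primitive[of T] T by (simp add: primitive_end)
qed

lemma continuous_on_smoothing_deriv: "continuous_on {0..T} (smoothing_deriv T w)"
proof (rule continuous_on_eq)
  show "continuous_on {0..T} (primitive T (\<lambda>r. smoothing T w r - w r))"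
    using integrable_smoothing int_w by (intro continuous_on_primitive) auto
qed (simp add: smoothing_deriv_eq_primitive)

end

section \<open>The Sobolev space and the energy\<close>

text \<open>The derivative of a member of the space is only Lebesgue measurable, and \<open>deriv\<close> takes
  arbitrary values where the function is not differentiable. It is replaced by a Borel function
  \<open>v\<close>, so that Fubini's theorem for Borel functions applies. The measurability of \<open>deriv h\<close> itself (the
  definition of the space speaks of its square) comes from its gauge integrability.\<close>
lemma sobolev_W21D:
  assumes h: "h \<in> sobolev_W21 T" and T: "0 < T"
  obtains v where "v \<in> borel_measurable borel" "integrable (segment T) (\<lambda>s. (v s)\<^sup>2)"
    "integrable (segment T) v" "AE s in segment T. deriv h s = v s"
    "\<And>s. s \<in> {0..T} \<Longrightarrow> h s = h 0 + primitive T v s"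
proof -
  have ac: "abs_continuous_on 0 T h"
    and diff: "AE s in lebesgue_on {0..T}. h differentiable (at s)"
    and sq: "integrable (lebesgue_on {0..T}) (\<lambda>s. (deriv h s)\<^sup>2)"
    using h by (auto simp: sobolev_W21_def)
  from diff have "AE s in lebesgue. s \<in> {0..T} \<longrightarrow> h differentiable (at s)"
    by (subst (asm) AE_restrict_space_iff) auto
  then obtain N where N: "N \<in> null_sets lebesgue" "{s. \<not> (s \<in> {0..T} \<longrightarrow> h differentiable (at s))} \<subseteq> N"
    unfolding eventually_ae_filter by auto
  have neg: "negligible N" using N by (simp add: negligible_iff_null_sets)
  have ftc: "(deriv h has_integral (h s - h 0)) {0..s}" if s: "s \<in> {0..T}" for s
  proof (rule abs_continuous_fundamental_theorem[OF _ _ neg])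
    show "abs_continuous_on 0 s h"
      by (rule abs_continuous_on_subinterval[OF ac]) (use s in auto)
    fix x assume "x \<in> {0<..<s} - N"
    then have "x \<notin> N" "x \<in> {0..T}" using s by auto
    then have "h differentiable (at x)" using N(2) by blast
    then show "(h has_real_derivative deriv h x) (at x)"
      by (simp add: DERIV_deriv_iff_real_differentiable)
  qed (use s in auto)
  have "deriv h integrable_on {0..T}" using ftc[of T] T by auto
  then have "deriv h \<in> borel_measurable (lebesgue_on {0..T})" by (rule integrable_imp_measurable)
  then have "(\<lambda>s. indicator {0..T} s * deriv h s) \<in> borel_measurable lebesgue"
    by (subst (asm) borel_measurable_restrict_space_iff) auto
  then obtain v where v [measurable]: "v \<in> borel_measurable lborel"
    and ae: "AE s in lborel. indicator {0..T} s * deriv h s = v s"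
    using completion_ex_borel_measurable_real by blast
  have ae_v: "AE s in segment T. deriv h s = v s"
    unfolding AE_segment using ae by eventually_elim (auto simp: indicator_def)
  have "integrable lebesgue (\<lambda>s. indicator {0..T} s * (deriv h s)\<^sup>2)"
    using sq by (subst (asm) integrable_restrict_space) auto
  then have "integrable lebesgue (\<lambda>s. indicator {0..T} s * (v s)\<^sup>2)"
  proof (rule integrable_cong_AE_imp)
    show "AE s in lebesgue. indicator {0..T} s * (deriv h s)\<^sup>2 = indicator {0..T} s * (v s)\<^sup>2"
      using AE_completion[OF ae] by eventually_elim (auto simp: indicator_def)
    show "(\<lambda>s. indicator {0..T} s * (v s)\<^sup>2) \<in> borel_measurable lebesgue"
      by (rule measurable_completion) measurable
  qed
  then have "integrable lborel (\<lambda>s. indicator {0..T} s * (v s)\<^sup>2)"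
    by (subst (asm) integrable_completion) auto
  then have v2: "integrable (segment T) (\<lambda>s. (v s)\<^sup>2)"
    using set_integrable_segment[of "\<lambda>s. (v s)\<^sup>2" T] by (simp add: set_integrable_def)
  then have v1: "integrable (segment T) v"
    by (rule segment.square_integrable_imp_integrable[rotated]) measurable
  obtain N' where N': "{s \<in> space lborel. \<not> indicator {0..T} s * deriv h s = v s} \<subseteq> N'"
    "emeasure lborel N' = 0" "N' \<in> sets lborel"
    by (rule AE_E[OF ae])
  have neg': "negligible N'" using N'(2,3) by (auto simp: negligible_iff_null_sets intro: null_sets_completionI)
  have "h s = h 0 + primitive T v s" if s: "s \<in> {0..T}" for s
  proof -
    have "(v has_integral (h s - h 0)) {0..s}"
    proof (rule has_integral_spike[OF neg' _ ftc[OF s]])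
      fix x assume "x \<in> {0..s} - N'"
      then have "indicator {0..T} x * deriv h x = v x" "x \<in> {0..T}"
        using subsetD[OF N'(1), of x] s by auto
      then show "v x = deriv h x" by simp
    qed
    then have "primitive T v s = h s - h 0"
      by (intro primitive_eqI v1) (use s v in auto)
    then show ?thesis by simp
  qed
  with _ v2 v1 ae_v show thesis by (rule that) (use v in simp)
qed

text \<open>The converse for a continuous derivative, which covers the minimizer.\<close>
lemma sobolev_W21I:
  assumes T: "0 < T" and g [measurable]: "g \<in> borel_measurable borel"
    and cont: "continuous_on {0..T} g" and ext: "h \<in> extensional {0..T}"
    and h: "\<And>s. s \<in> {0..T} \<Longrightarrow> h s = c + primitive T g s"
  shows "h \<in> sobolev_W21 T" and "AE s in segment T. deriv h s = g s"
proof -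
  have "bounded (g ` {0..T})" by (intro compact_imp_bounded compact_continuous_image cont) auto
  then obtain C where "\<forall>y\<in>g ` {0..T}. norm y \<le> C" unfolding bounded_iff by blast
  then have C: "\<bar>g s\<bar> \<le> C" if "s \<in> {0..T}" for s using that by simp
  have int_g: "integrable (segment T) g" by (rule integrable_segment_bounded[OF g C])
  have h_integral: "h s = c + integral {0..s} g" if "s \<in> {0..T}" for s
    using h[OF that] integral_unique[OF has_integral_primitive[OF g int_g, of s]] that by simp
  have der: "(h has_real_derivative g s) (at s)" if s: "s \<in> {0<..<T}" for s
  proof -
    have "((\<lambda>x. integral {0..x} g) has_real_derivative g s) (at s within {0..T})"
      by (rule integral_has_real_derivative[OF cont]) (use s in auto)
    then have "((\<lambda>x. c + integral {0..x} g) has_real_derivative 0 + g s) (at s within {0..T})"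
      by (rule DERIV_add[OF DERIV_const])
    then have "((\<lambda>x. c + integral {0..x} g) has_real_derivative g s) (at s)"
      using s at_within_Icc_at[of 0 s T] by simp
    then show ?thesis
      by (rule DERIV_cong_ev[THEN iffD1, OF refl _ refl, rotated])
        (use s in \<open>auto simp: eventually_nhds h_integral intro!: exI[of _ "{0<..<T}"]\<close>)
  qed
  have inside: "AE s in lborel. s \<in> {0..T} \<longrightarrow> s \<in> {0<..<T}"
    using AE_lborel_singleton[of 0] AE_lborel_singleton[of T] by eventually_elim auto
  then show ae: "AE s in segment T. deriv h s = g s"
    unfolding AE_segment by eventually_elim (use der in \<open>auto intro: DERIV_imp_deriv\<close>)
  have ac: "abs_continuous_on 0 T h"
  proof (rule abs_continuous_on_lipschitz[where C = C])
    fix x y :: real assume xy: "0 \<le> x" "x \<le> y" "y \<le> T"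
    have int: "g integrable_on {0..y}" using has_integral_primitive[OF g int_g, of y] xy by auto
    have "integral {0..x} g + integral {x..y} g = integral {0..y} g"
      by (rule Henstock_Kurzweil_Integration.integral_combine[OF _ _ int]) (use xy in auto)
    then have "h y - h x = integral {x..y} g" using h_integral xy by simp
    moreover have "norm (integral {x..y} g) \<le> C * (y - x)"
      by (rule integral_bound) (use xy cont C in \<open>auto intro: continuous_on_subset\<close>)
    ultimately show "\<bar>h y - h x\<bar> \<le> C * (y - x)" by simp
  qed
  have "AE s in lebesgue. s \<in> {0..T} \<longrightarrow> h differentiable (at s)"
    by (rule AE_mp[OF AE_completion[OF inside]]) (use der in \<open>auto intro!: AE_I2 simp: real_differentiable_def\<close>)
  then have diff: "AE s in lebesgue_on {0..T}. h differentiable (at s)"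
    by (subst AE_restrict_space_iff) auto
  have "integrable lborel (\<lambda>s. indicator {0..T} s * (g s)\<^sup>2)"
  proof -
    have "integrable (segment T) (\<lambda>s. (g s)\<^sup>2)"
      by (rule integrable_segment_square_bounded[OF g C])
    then show ?thesis
      using set_integrable_segment[of "\<lambda>s. (g s)\<^sup>2" T] by (simp add: set_integrable_def)
  qed
  then have "integrable lebesgue (\<lambda>s. indicator {0..T} s * (g s)\<^sup>2)"
    by (subst integrable_completion) auto
  then have int_g2: "integrable (lebesgue_on {0..T}) (\<lambda>s. (g s)\<^sup>2)"
    by (subst integrable_restrict_space) auto
  have ae2: "AE s in lebesgue_on {0..T}. (g s)\<^sup>2 = (deriv h s)\<^sup>2"
  proof -
    have "AE s in lebesgue. s \<in> {0..T} \<longrightarrow> (g s)\<^sup>2 = (deriv h s)\<^sup>2"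
      using AE_completion[OF ae[unfolded AE_segment]] by eventually_elim auto
    then show ?thesis by (subst AE_restrict_space_iff) auto
  qed
  have meas2: "(\<lambda>s. (deriv h s)\<^sup>2) \<in> borel_measurable (lebesgue_on {0..T})"
  proof -
    have "(\<lambda>s. indicator {0..T} s * (g s)\<^sup>2) \<in> borel_measurable lebesgue"
      by (rule measurable_completion) measurable
    moreover have "AE s in lebesgue. indicator {0..T} s * (g s)\<^sup>2 = indicator {0..T} s * (deriv h s)\<^sup>2"
      using AE_completion[OF ae[unfolded AE_segment]] by eventually_elim (auto simp: indicator_def)
    ultimately have "(\<lambda>s. indicator {0..T} s * (deriv h s)\<^sup>2) \<in> borel_measurable lebesgue"
      by (rule borel_measurable_AE)
    then show ?thesis by (subst borel_measurable_restrict_space_iff) auto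
  qed
  have "integrable (lebesgue_on {0..T}) (\<lambda>s. (deriv h s)\<^sup>2)"
    by (rule integrable_cong_AE_imp[OF int_g2 meas2 ae2])
  then show "h \<in> sobolev_W21 T" using ac diff ext by (simp add: sobolev_W21_def)
qed

lemma energy_eq_nn_integral_segment:
  assumes [measurable]: "F \<in> borel_measurable borel" "v \<in> borel_measurable borel" "w \<in> borel_measurable borel"
    and h: "\<And>s. s \<in> {0..T} \<Longrightarrow> h s = F s" and ae: "AE s in segment T. deriv h s = v s"
  shows "energy T h w = (\<integral>\<^sup>+s. ennreal ((F s - w s)\<^sup>2 + (v s)\<^sup>2) \<partial>segment T)"
proof -
  have "energy T h w = (\<integral>\<^sup>+s. ennreal ((h s - w s)\<^sup>2 + (deriv h s)\<^sup>2) * indicator {0..T} s \<partial>lborel)"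
    unfolding energy_def by (subst nn_integral_restrict_space) (auto simp: nn_integral_completion)
  also have "\<dots> = (\<integral>\<^sup>+s. ennreal ((F s - w s)\<^sup>2 + (v s)\<^sup>2) * indicator {0..T} s \<partial>lborel)"
    by (rule nn_integral_cong_AE)
      (rule AE_mp[OF ae[unfolded AE_segment]], auto simp: h indicator_def intro!: AE_I2)
  also have "\<dots> = (\<integral>\<^sup>+s. ennreal ((F s - w s)\<^sup>2 + (v s)\<^sup>2) \<partial>segment T)"
    by (rule nn_integral_segment[symmetric]) measurable
  finally show ?thesis .
qed


section \<open>The minimizer and the minimal energy\<close>

lemma measure_segment: "0 \<le> T \<Longrightarrow> measure (segment T) UNIV = T"
  using integral_segment[of "\<lambda>_. 1" T] by (simp add: set_lebesgue_integral_def)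

context
  fixes T :: real and w :: "real \<Rightarrow> real"
  assumes T: "0 < T" and w [measurable]: "w \<in> borel_measurable borel"
    and int_w2: "integrable (segment T) (\<lambda>s. (w s)\<^sup>2)"
begin

private lemma int_w: "integrable (segment T) w"
  by (rule segment.square_integrable_imp_integrable[OF _ int_w2]) measurable

private lemma int_smoothing2:
  "integrable (segment T) (\<lambda>s. (smoothing T w s)\<^sup>2)"
  "integrable (segment T) (\<lambda>s. (smoothing_deriv T w s)\<^sup>2)"
  by (rule integrable_segment_square_bounded[OF _ smoothing_bounded[OF T w int_w]], measurable)
    (rule integrable_segment_square_bounded[OF _ smoothing_deriv_bounded[OF T w int_w]], measurable)

private lemma int_residual2: "integrable (segment T) (\<lambda>s. (smoothing T w s - w s)\<^sup>2)"
  unfolding power2_diff mult.assoc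
  by (intro Bochner_Integration.integrable_diff Bochner_Integration.integrable_add int_smoothing2 int_w2
      integrable_mult_right integrable_mult_square_integrable) measurable

definition "minimal_energy = (\<integral>s. (smoothing T w s - w s)\<^sup>2 + (smoothing_deriv T w s)\<^sup>2 \<partial>segment T)"

text \<open>The first variation of the energy at the minimizer vanishes; the function \<open>c + primitive T \<psi>\<close>
  is an arbitrary test function with derivative \<open>\<psi>\<close>.\<close>
private lemma euler_lagrange:
  assumes [measurable]: "\<psi> \<in> borel_measurable borel" and \<psi>: "integrable (segment T) \<psi>"
  shows "(\<integral>s. (smoothing T w s - w s) * (c + primitive T \<psi> s) \<partial>segment T)
    = - (\<integral>s. smoothing_deriv T w s * \<psi> s \<partial>segment T)"
proof -
  have "(\<integral>s. (smoothing T w s - w s) * (c + primitive T \<psi> s) \<partial>segment T)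
      = - (\<integral>s. primitive T (\<lambda>r. smoothing T w r - w r) s * \<psi> s \<partial>segment T)"
    using integral_smoothing_minus[OF T w int_w] integrable_smoothing[OF T w int_w] int_w \<psi>
    by (intro primitive_by_parts) auto
  also have "(\<integral>s. primitive T (\<lambda>r. smoothing T w r - w r) s * \<psi> s \<partial>segment T)
      = (\<integral>s. smoothing_deriv T w s * \<psi> s \<partial>segment T)"
  proof (rule integral_cong_AE)
    show "AE s in segment T. primitive T (\<lambda>r. smoothing T w r - w r) s * \<psi> s = smoothing_deriv T w s * \<psi> s"
      using AE_segment_mem[of T]
      by eventually_elim (simp add: smoothing_deriv_eq_primitive[OF T w int_w])
  qed measurable
  finally show ?thesis .
qed

text \<open>The energy of a competitor exceeds the minimal one by the squared \<open>W\<^sub>2\<^sup>1\<close>-norm of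
  the difference. This yields the minimality and the uniqueness of the minimizer at once.\<close>
private lemma energy_decomposition:
  assumes h: "h \<in> sobolev_W21 T"
  obtains c \<psi> where "\<psi> \<in> borel_measurable borel"
    "integrable (segment T) \<psi>"
    "integrable (segment T) (\<lambda>s. (c + primitive T \<psi> s)\<^sup>2)" "integrable (segment T) (\<lambda>s. (\<psi> s)\<^sup>2)"
    "\<And>s. s \<in> {0..T} \<Longrightarrow> h s = smoothing T w s + (c + primitive T \<psi> s)"
    "energy T h w = ennreal (minimal_energy + (\<integral>s. (c + primitive T \<psi> s)\<^sup>2 + (\<psi> s)\<^sup>2 \<partial>segment T))"
proof -
  let ?L = "segment T" and ?f = "smoothing T w" and ?g = "smoothing_deriv T w"
  from sobolev_W21D[OF h T] obtain v where [measurable]: "v \<in> borel_measurable borel"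
    and v2: "integrable ?L (\<lambda>s. (v s)\<^sup>2)" and v1: "integrable ?L v"
    and ae: "AE s in ?L. deriv h s = v s" and hv: "\<And>s. s \<in> {0..T} \<Longrightarrow> h s = h 0 + primitive T v s"
    by metis
  define c where "c = h 0 - ?f 0"
  define \<psi> where "\<psi> = (\<lambda>s. v s - ?g s)"
  define \<phi> where "\<phi> s = c + primitive T \<psi> s" for s
  have [measurable]: "\<psi> \<in> borel_measurable borel" unfolding \<psi>_def by measurable
  have [measurable]: "\<phi> \<in> borel_measurable borel" unfolding \<phi>_def by measurable
  have \<psi>1: "integrable ?L \<psi>" unfolding \<psi>_def using v1 integrable_smoothing[OF T w int_w] by auto
  have \<psi>2: "integrable ?L (\<lambda>s. (\<psi> s)\<^sup>2)"
    unfolding \<psi>_def power2_diff mult.assoc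
    by (intro Bochner_Integration.integrable_diff Bochner_Integration.integrable_add int_smoothing2 v2
        integrable_mult_right integrable_mult_square_integrable) measurable
  have \<phi>_bound: "\<bar>\<phi> s\<bar> \<le> \<bar>c\<bar> + (\<integral>r. \<bar>\<psi> r\<bar> \<partial>?L)" for s
    unfolding \<phi>_def using abs_primitive_le[OF \<psi>1, of s] by linarith
  have \<phi>2: "integrable ?L (\<lambda>s. (\<phi> s)\<^sup>2)"
    by (rule integrable_segment_square_bounded[OF _ \<phi>_bound]) measurable
  have h_eq: "h s = ?f s + \<phi> s" if s: "s \<in> {0..T}" for s
    using hv[OF s] smoothing_eq_primitive[OF T w int_w s]
      primitive_diff[OF v1 integrable_smoothing(2)[OF T w int_w], of s]
    by (simp add: \<phi>_def \<psi>_def c_def)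
  have cross: "(\<integral>s. (?f s - w s) * \<phi> s \<partial>?L) = - (\<integral>s. ?g s * \<psi> s \<partial>?L)"
    unfolding \<phi>_def by (rule euler_lagrange) (use \<psi>1 in auto)
  have int1: "integrable ?L (\<lambda>s. (?f s - w s) * \<phi> s)" "integrable ?L (\<lambda>s. ?g s * \<psi> s)"
    using int_residual2 \<phi>2 \<psi>2 int_smoothing2 by (auto intro!: integrable_mult_square_integrable)
  have "energy T h w = (\<integral>\<^sup>+s. ennreal ((?f s + \<phi> s - w s)\<^sup>2 + (v s)\<^sup>2) \<partial>?L)"
    by (rule energy_eq_nn_integral_segment) (use h_eq ae in auto)
  also have "\<dots> = (\<integral>\<^sup>+s. ennreal (((?f s - w s)\<^sup>2 + (?g s)\<^sup>2) + ((\<phi> s)\<^sup>2 + (\<psi> s)\<^sup>2)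
      + 2 * ((?f s - w s) * \<phi> s + ?g s * \<psi> s)) \<partial>?L)"
    by (intro nn_integral_cong arg_cong[where f = ennreal])
      (simp add: \<psi>_def power2_eq_square algebra_simps)
  also have "\<dots> = ennreal (\<integral>s. ((?f s - w s)\<^sup>2 + (?g s)\<^sup>2) + ((\<phi> s)\<^sup>2 + (\<psi> s)\<^sup>2)
      + 2 * ((?f s - w s) * \<phi> s + ?g s * \<psi> s) \<partial>?L)"
  proof (rule nn_integral_eq_integral)
    show "integrable ?L (\<lambda>s. ((?f s - w s)\<^sup>2 + (?g s)\<^sup>2) + ((\<phi> s)\<^sup>2 + (\<psi> s)\<^sup>2)
      + 2 * ((?f s - w s) * \<phi> s + ?g s * \<psi> s))"
      using int_residual2 int_smoothing2 \<phi>2 \<psi>2 int1 by auto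
    have eq: "((?f s - w s)\<^sup>2 + (?g s)\<^sup>2) + ((\<phi> s)\<^sup>2 + (\<psi> s)\<^sup>2)
      + 2 * ((?f s - w s) * \<phi> s + ?g s * \<psi> s) = (?f s + \<phi> s - w s)\<^sup>2 + (?g s + \<psi> s)\<^sup>2" for s
      by (simp add: power2_eq_square algebra_simps)
    show "AE s in ?L. 0 \<le> ((?f s - w s)\<^sup>2 + (?g s)\<^sup>2) + ((\<phi> s)\<^sup>2 + (\<psi> s)\<^sup>2)
      + 2 * ((?f s - w s) * \<phi> s + ?g s * \<psi> s)"
      unfolding eq by simp
  qed
  also have "(\<integral>s. ((?f s - w s)\<^sup>2 + (?g s)\<^sup>2) + ((\<phi> s)\<^sup>2 + (\<psi> s)\<^sup>2)
      + 2 * ((?f s - w s) * \<phi> s + ?g s * \<psi> s) \<partial>?L)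
      = minimal_energy + (\<integral>s. (\<phi> s)\<^sup>2 + (\<psi> s)\<^sup>2 \<partial>?L)
        + 2 * ((\<integral>s. (?f s - w s) * \<phi> s \<partial>?L) + (\<integral>s. ?g s * \<psi> s \<partial>?L))"
    unfolding minimal_energy_def using int_residual2 int_smoothing2 \<phi>2 \<psi>2 int1
    by (simp add: Bochner_Integration.integral_add)
  finally have "energy T h w = ennreal (minimal_energy + (\<integral>s. (\<phi> s)\<^sup>2 + (\<psi> s)\<^sup>2 \<partial>?L))"
    unfolding cross by simp
  then show thesis
    by (intro that[of \<psi> c]) (use \<psi>1 \<psi>2 \<phi>2 h_eq in \<open>auto simp: \<phi>_def\<close>)
qed

private lemma smoothing_in_sobolev:
  "restrict (smoothing T w) {0..T} \<in> sobolev_W21 T"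
  "AE s in segment T. deriv (restrict (smoothing T w) {0..T}) s = smoothing_deriv T w s"
proof -
  have eq: "restrict (smoothing T w) {0..T} s = smoothing T w 0 + primitive T (smoothing_deriv T w) s"
    if "s \<in> {0..T}" for s
    using smoothing_eq_primitive[OF T w int_w that] that by (metis restrict_apply')
  show "restrict (smoothing T w) {0..T} \<in> sobolev_W21 T"
    "AE s in segment T. deriv (restrict (smoothing T w) {0..T}) s = smoothing_deriv T w s"
    by (rule sobolev_W21I[OF T _ continuous_on_smoothing_deriv[OF T w int_w] restrict_extensional eq],
        measurable)+
qed

lemma energy_smoothing: "energy T (restrict (smoothing T w) {0..T}) w = ennreal minimal_energy"
proof -
  have "energy T (restrict (smoothing T w) {0..T}) w
      = (\<integral>\<^sup>+s. ennreal ((smoothing T w s - w s)\<^sup>2 + (smoothing_deriv T w s)\<^sup>2) \<partial>segment T)"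
    by (rule energy_eq_nn_integral_segment) (use smoothing_in_sobolev(2) in auto)
  also have "\<dots> = ennreal minimal_energy"
    unfolding minimal_energy_def
    by (rule nn_integral_eq_integral) (use int_residual2 int_smoothing2 in auto)
  finally show ?thesis .
qed

lemma minimal_energy_nonneg: "0 \<le> minimal_energy"
  unfolding minimal_energy_def by simp

lemma energy_minimizer_eq_smoothing: "energy_minimizer T w = restrict (smoothing T w) {0..T}"
  unfolding energy_minimizer_def
proof (rule the_equality)
  show "is_energy_minimizer T w (restrict (smoothing T w) {0..T})"
    unfolding is_energy_minimizer_def
  proof (intro conjI ballI smoothing_in_sobolev(1))
    fix h assume "h \<in> sobolev_W21 T"
    then obtain c \<psi> where
      "energy T h w = ennreal (minimal_energy + (\<integral>s. (c + primitive T \<psi> s)\<^sup>2 + (\<psi> s)\<^sup>2 \<partial>segment T))"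
      by (rule energy_decomposition)
    then show "energy T (restrict (smoothing T w) {0..T}) w \<le> energy T h w"
      unfolding energy_smoothing by (simp add: ennreal_leI)
  qed
next
  fix h assume min: "is_energy_minimizer T w h"
  then have hW: "h \<in> sobolev_W21 T" by (simp add: is_energy_minimizer_def)
  let ?L = "segment T"
  from hW obtain c \<psi> where [measurable]: "\<psi> \<in> borel_measurable borel"
    and \<psi>: "integrable ?L \<psi>"
      "integrable ?L (\<lambda>s. (c + primitive T \<psi> s)\<^sup>2)" "integrable ?L (\<lambda>s. (\<psi> s)\<^sup>2)"
    and h_eq: "\<And>s. s \<in> {0..T} \<Longrightarrow> h s = smoothing T w s + (c + primitive T \<psi> s)"
    and en: "energy T h w = ennreal (minimal_energy + (\<integral>s. (c + primitive T \<psi> s)\<^sup>2 + (\<psi> s)\<^sup>2 \<partial>?L))"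
    by (rule energy_decomposition) blast
  have "energy T h w \<le> ennreal minimal_energy"
    using min smoothing_in_sobolev(1) energy_smoothing by (metis is_energy_minimizer_def)
  then have "(\<integral>s. (c + primitive T \<psi> s)\<^sup>2 + (\<psi> s)\<^sup>2 \<partial>?L) \<le> 0"
    unfolding en using minimal_energy_nonneg by (simp add: ennreal_le_iff)
  then have "(\<integral>s. (c + primitive T \<psi> s)\<^sup>2 + (\<psi> s)\<^sup>2 \<partial>?L) = 0"
    by (intro antisym) auto
  then have zero: "AE s in ?L. (c + primitive T \<psi> s)\<^sup>2 + (\<psi> s)\<^sup>2 = 0"
    using \<psi> by (subst (asm) integral_nonneg_eq_0_iff_AE) auto
  then have "AE s in ?L. \<psi> s = 0" by eventually_elim (simp add: sum_power2_eq_zero_iff)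
  then have prim: "primitive T \<psi> s = 0" for s
    unfolding primitive_def by (intro integral_eq_zero_AE) (auto elim!: AE_mp)
  \<comment> \<open>As the primitive vanishes, the difference to the minimizer is the constant \<open>c\<close>.\<close>
  from zero have "AE s in ?L. c = 0"
    by eventually_elim (simp add: sum_power2_eq_zero_iff prim)
  then have "(\<integral>s. c \<partial>?L) = 0" by (intro integral_eq_zero_AE)
  then have "c = 0" using measure_segment[of T] T by simp
  then have "h s = smoothing T w s" if "s \<in> {0..T}" for s using h_eq[OF that] prim by simp
  moreover have "h \<in> extensional {0..T}" using hW by (simp add: sobolev_W21_def)
  ultimately show "h = restrict (smoothing T w) {0..T}"
    by (auto simp: extensional_def restrict_def fun_eq_iff)
qed

text \<open>The Euler-Lagrange equation tested with the minimizer itself.\<close>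
lemma minimal_energy_eq:
  "minimal_energy = (\<integral>s. (w s)\<^sup>2 \<partial>segment T) - (\<integral>s. w s * smoothing T w s \<partial>segment T)"
proof -
  let ?L = "segment T" and ?f = "smoothing T w" and ?g = "smoothing_deriv T w"
  have "(\<integral>s. (?f s - w s) * ?f s \<partial>?L) = (\<integral>s. (?f s - w s) * (?f 0 + primitive T ?g s) \<partial>?L)"
  proof (rule integral_cong_AE)
    show "AE s in ?L. (?f s - w s) * ?f s = (?f s - w s) * (?f 0 + primitive T ?g s)"
      using AE_segment_mem[of T] by eventually_elim (metis smoothing_eq_primitive[OF T w int_w])
  qed measurable
  also have "\<dots> = - (\<integral>s. ?g s * ?g s \<partial>?L)"
    by (rule euler_lagrange) (use integrable_smoothing[OF T w int_w] in auto)
  finally have 1: "(\<integral>s. (?f s - w s) * ?f s \<partial>?L) + (\<integral>s. ?g s * ?g s \<partial>?L) = 0" by simp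
  have int: "integrable ?L (\<lambda>s. (?f s - w s) * ?f s)" "integrable ?L (\<lambda>s. ?g s * ?g s)"
    "integrable ?L (\<lambda>s. w s * ?f s)"
    using int_residual2 int_smoothing2 int_w2 by (auto intro!: integrable_mult_square_integrable)
  have "minimal_energy = (\<integral>s. ((?f s - w s) * ?f s + ?g s * ?g s) + ((w s)\<^sup>2 - w s * ?f s) \<partial>?L)"
    unfolding minimal_energy_def
    by (rule Bochner_Integration.integral_cong) (simp_all add: power2_eq_square algebra_simps)
  also have "\<dots> = ((\<integral>s. (?f s - w s) * ?f s \<partial>?L) + (\<integral>s. ?g s * ?g s \<partial>?L))
      + ((\<integral>s. (w s)\<^sup>2 \<partial>?L) - (\<integral>s. w s * ?f s \<partial>?L))"
    using int int_w2 by simp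
  finally show ?thesis using 1 by simp
qed

text \<open>Expanding the square, each of the two pure terms integrates to \<open>\<integral> w\<^sup>2\<close>, since the kernel is
  symmetric with total mass \<open>1\<close> in each variable. The gain over \<open>minimal_energy_eq\<close> is
  an integrand that is nonnegative and involves increments only, so that Tonelli's theorem
  and the stationarity of increments apply.\<close>
lemma minimal_energy_eq_double_integral:
  "ennreal minimal_energy
    = (\<integral>\<^sup>+s. \<integral>\<^sup>+t. ennreal (neumann_kernel T s t * (w s - w t)\<^sup>2 / 2) \<partial>segment T \<partial>segment T)"
proof -
  let ?L = "segment T" and ?G = "neumann_kernel T"
  have bound: "AE s in ?L. AE t in ?L. \<bar>?G s t\<bar> \<le> cosh T / sinh T"
    using AE_segment_mem[of T]
  proof eventually_elim
    case (elim s)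
    show ?case using AE_segment_mem[of T] by eventually_elim (rule neumann_kernel_bounded[OF T elim])
  qed
  have K: "integrable (?L \<Otimes>\<^sub>M ?L) (\<lambda>(s, t). u s * (?G s t * v t))"
    if "integrable ?L u" "integrable ?L v" for u v
    by (rule segment_pair.integrable_bounded_kernel[OF _ bound that]) measurable
  have one: "integrable ?L (\<lambda>_. 1 :: real)" by simp
  have G1: "(\<integral>s. (w s)\<^sup>2 * (\<integral>t. ?G s t \<partial>?L) \<partial>?L) = (\<integral>s. (w s)\<^sup>2 \<partial>?L)"
  proof (rule integral_cong_AE)
    show "AE s in ?L. (w s)\<^sup>2 * (\<integral>t. ?G s t \<partial>?L) = (w s)\<^sup>2"
      using AE_segment_mem[of T] by eventually_elim (simp add: integral_neumann_kernel[OF T])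
  qed measurable
  note K1 = K[OF int_w2 one] and K2 = K[OF one int_w2] and K3 = K[OF int_w int_w]
  have I1: "(\<integral>p. (case p of (s, t) \<Rightarrow> (w s)\<^sup>2 * (?G s t * 1)) \<partial>(?L \<Otimes>\<^sub>M ?L)) = (\<integral>s. (w s)\<^sup>2 \<partial>?L)"
    using segment_pair.integral_fst'[OF K1] G1 by simp
  have I2: "(\<integral>p. (case p of (s, t) \<Rightarrow> 1 * (?G s t * (w t)\<^sup>2)) \<partial>(?L \<Otimes>\<^sub>M ?L)) = (\<integral>s. (w s)\<^sup>2 \<partial>?L)"
    using segment_pair.integral_fst'[OF K2] segment_pair.Fubini_integral[OF K2] G1
    by (simp add: neumann_kernel_commute[OF T] mult.commute)
  have I3: "(\<integral>p. (case p of (s, t) \<Rightarrow> w s * (?G s t * w t)) \<partial>(?L \<Otimes>\<^sub>M ?L)) = (\<integral>s. w s * smoothing T w s \<partial>?L)"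
    using segment_pair.integral_fst'[OF K3] by (simp add: smoothing_def)
  let ?F = "\<lambda>p. ((case p of (s, t) \<Rightarrow> (w s)\<^sup>2 * (?G s t * 1)) + (case p of (s, t) \<Rightarrow> 1 * (?G s t * (w t)\<^sup>2))) / 2
      - (case p of (s, t) \<Rightarrow> w s * (?G s t * w t))"
  have F: "?F (s, t) = ?G s t * (w s - w t)\<^sup>2 / 2" for s t
    by (simp add: power2_eq_square field_simps)
  have "(\<integral>\<^sup>+s. \<integral>\<^sup>+t. ennreal (?G s t * (w s - w t)\<^sup>2 / 2) \<partial>?L \<partial>?L) = (\<integral>\<^sup>+p. ennreal (?F p) \<partial>(?L \<Otimes>\<^sub>M ?L))"
    unfolding F[symmetric] by (rule segment.nn_integral_fst[where f = "\<lambda>p. ennreal (?F p)"]) measurable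
  also have "\<dots> = ennreal (\<integral>p. ?F p \<partial>(?L \<Otimes>\<^sub>M ?L))"
  proof (rule nn_integral_eq_integral)
    show "integrable (?L \<Otimes>\<^sub>M ?L) ?F" using K1 K2 K3 by auto
    show "AE p in ?L \<Otimes>\<^sub>M ?L. 0 \<le> ?F p"
    proof (rule AE_I2)
      fix p show "0 \<le> ?F p"
        by (cases p) (simp only: F, simp add: neumann_kernel_nonneg[OF T])
    qed
  qed
  also have "(\<integral>p. ?F p \<partial>(?L \<Otimes>\<^sub>M ?L)) = ((\<integral>s. (w s)\<^sup>2 \<partial>?L) + (\<integral>s. (w s)\<^sup>2 \<partial>?L)) / 2 - (\<integral>s. w s * smoothing T w s \<partial>?L)"
    using K1 K2 K3 unfolding I3[symmetric] by (simp only: I1 I2 Bochner_Integration.integral_diff Bochner_Integration.integral_add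
      integral_divide_zero Bochner_Integration.integrable_add integrable_divide)
  also have "\<dots> = minimal_energy" unfolding minimal_energy_eq by simp
  finally show ?thesis ..
qed

end

section \<open>The mean energy of fractional Brownian motion\<close>

context fractional_brownian_motion
begin

lemma measurable_W [measurable]: "W t \<in> borel_measurable M"
  using measurable_compose[OF _ jointly_measurable, of "\<lambda>\<omega>. (t, \<omega>)" M] by simp

lemma measurable_path: "\<omega> \<in> space M \<Longrightarrow> (\<lambda>t. W t \<omega>) \<in> borel_measurable borel"
  using measurable_compose[OF _ jointly_measurable, of "\<lambda>t. (t, \<omega>)" borel] by simp

lemma measurable_W_pair [measurable (raw)]:
  assumes "f \<in> borel_measurable N" "g \<in> measurable N M"
  shows "(\<lambda>x. W (f x) (g x)) \<in> borel_measurable N"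
  using measurable_compose[OF measurable_Pair[OF assms] jointly_measurable] by simp

lemma nn_second_moment: "(\<integral>\<^sup>+\<omega>. ennreal ((W t \<omega>)\<^sup>2) \<partial>M) = ennreal (\<bar>t\<bar> powr (2 * H))"
proof (cases "t = 0")
  case True
  have "(\<integral>\<^sup>+\<omega>. ennreal ((W 0 \<omega>)\<^sup>2) \<partial>M) = (\<integral>\<^sup>+\<omega>. 0 \<partial>M)"
    by (rule nn_integral_cong_AE) (use start_zero in \<open>eventually_elim, simp\<close>)
  then show ?thesis using True by simp
next
  case False
  then have "expectation (\<lambda>\<omega>. (W t \<omega>)\<^sup>2) \<noteq> 0" by (simp add: second_moment)
  then have "integrable M (\<lambda>\<omega>. (W t \<omega>)\<^sup>2)" using not_integrable_integral_eq by blast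
  then show ?thesis by (simp add: nn_integral_eq_integral second_moment)
qed

text \<open>Stationarity is used for the single time \<open>s - t\<close> and the shift \<open>t\<close>.\<close>
lemma nn_increment_moment:
  "(\<integral>\<^sup>+\<omega>. ennreal ((W s \<omega> - W t \<omega>)\<^sup>2) \<partial>M) = ennreal (\<bar>s - t\<bar> powr (2 * H))"
proof -
  let ?r = "s - t" and ?P = "\<Pi>\<^sub>M t\<in>{s - t}. (borel :: real measure)"
  let ?g = "\<lambda>x. ennreal ((x ?r)\<^sup>2)"
  have distr: "distr M ?P (\<lambda>\<omega>. \<lambda>u\<in>{?r}. W (u + t) \<omega> - W t \<omega>) = distr M ?P (\<lambda>\<omega>. \<lambda>u\<in>{?r}. W u \<omega> - W 0 \<omega>)"
    using stationary unfolding stationary_increments_def by blast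
  have [measurable]: "?g \<in> borel_measurable ?P" by measurable
  have *: "(\<integral>\<^sup>+x. ?g x \<partial>distr M ?P (\<lambda>\<omega>. \<lambda>u\<in>{?r}. F u \<omega>)) = (\<integral>\<^sup>+\<omega>. ennreal ((F ?r \<omega>)\<^sup>2) \<partial>M)"
    if "\<And>u. F u \<in> borel_measurable M" for F
    by (subst nn_integral_distr) (use that in \<open>auto intro!: measurable_restrict\<close>)
  have "(\<integral>\<^sup>+\<omega>. ennreal ((W s \<omega> - W t \<omega>)\<^sup>2) \<partial>M) = (\<integral>\<^sup>+\<omega>. ennreal ((W ?r \<omega> - W 0 \<omega>)\<^sup>2) \<partial>M)"
    using *[of "\<lambda>u \<omega>. W (u + t) \<omega> - W t \<omega>"] *[of "\<lambda>u \<omega>. W u \<omega> - W 0 \<omega>"] distr by simp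
  also have "\<dots> = (\<integral>\<^sup>+\<omega>. ennreal ((W ?r \<omega>)\<^sup>2) \<partial>M)"
    by (rule nn_integral_cong_AE) (use start_zero in \<open>eventually_elim, simp\<close>)
  finally show ?thesis by (simp add: nn_second_moment)
qed

text \<open>The paths for which the minimizer is described above.\<close>
lemma AE_path_square_integrable:
  assumes T: "0 < T"
  shows "AE \<omega> in M. integrable (segment T) (\<lambda>s. (W s \<omega>)\<^sup>2)"
proof -
  interpret P: pair_sigma_finite "segment T" M ..
  have "(\<integral>\<^sup>+\<omega>. \<integral>\<^sup>+s. ennreal ((W s \<omega>)\<^sup>2) \<partial>segment T \<partial>M) = (\<integral>\<^sup>+s. \<integral>\<^sup>+\<omega>. ennreal ((W s \<omega>)\<^sup>2) \<partial>M \<partial>segment T)"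
    by (rule P.Fubini') measurable
  also have "\<dots> = (\<integral>\<^sup>+s. ennreal (\<bar>s\<bar> powr (2 * H)) \<partial>segment T)"
    by (simp add: nn_second_moment)
  also have "\<dots> < \<infinity>"
  proof -
    have "integrable (segment T) (\<lambda>s. \<bar>s\<bar> powr (2 * H))"
      by (rule integrable_segment_bounded[where B = "T powr (2 * H)"])
        (use H_pos in \<open>auto intro!: powr_mono2\<close>)
    then show ?thesis by (subst nn_integral_eq_integral) auto
  qed
  finally have "(\<integral>\<^sup>+\<omega>. \<integral>\<^sup>+s. ennreal ((W s \<omega>)\<^sup>2) \<partial>segment T \<partial>M) \<noteq> \<infinity>"
    by (simp add: less_top)
  then have "AE \<omega> in M. (\<integral>\<^sup>+s. ennreal ((W s \<omega>)\<^sup>2) \<partial>segment T) \<noteq> \<infinity>"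
    by (rule nn_integral_PInf_AE[rotated]) measurable
  then show ?thesis
  proof (rule AE_mp, intro AE_I2 impI)
    fix \<omega> assume \<omega>: "\<omega> \<in> space M" and fin: "(\<integral>\<^sup>+s. ennreal ((W s \<omega>)\<^sup>2) \<partial>segment T) \<noteq> \<infinity>"
    have [measurable]: "(\<lambda>s. W s \<omega>) \<in> borel_measurable borel" by (rule measurable_path[OF \<omega>])
    show "integrable (segment T) (\<lambda>s. (W s \<omega>)\<^sup>2)"
      using fin by (intro integrableI_bounded) (auto simp: less_top)
  qed
qed

lemma mean_energy_eq:
  assumes T: "0 < T"
  shows "(\<integral>\<^sup>+\<omega>. energy T (energy_minimizer T (\<lambda>s. W s \<omega>)) (\<lambda>s. W s \<omega>) \<partial>M)
    = (\<integral>\<^sup>+s. \<integral>\<^sup>+t. ennreal (neumann_kernel T s t * \<bar>s - t\<bar> powr (2 * H) / 2) \<partial>segment T \<partial>segment T)"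
proof -
  interpret P: pair_sigma_finite "segment T" M ..
  let ?e = "\<lambda>s t \<omega>. ennreal (neumann_kernel T s t * (W s \<omega> - W t \<omega>)\<^sup>2 / 2)"
  have "(\<integral>\<^sup>+\<omega>. energy T (energy_minimizer T (\<lambda>s. W s \<omega>)) (\<lambda>s. W s \<omega>) \<partial>M)
      = (\<integral>\<^sup>+\<omega>. \<integral>\<^sup>+s. \<integral>\<^sup>+t. ?e s t \<omega> \<partial>segment T \<partial>segment T \<partial>M)"
  proof (rule nn_integral_cong_AE)
    show "AE \<omega> in M. energy T (energy_minimizer T (\<lambda>s. W s \<omega>)) (\<lambda>s. W s \<omega>)
        = (\<integral>\<^sup>+s. \<integral>\<^sup>+t. ?e s t \<omega> \<partial>segment T \<partial>segment T)"
      using AE_path_square_integrable[OF T] AE_space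
    proof eventually_elim
      case (elim \<omega>)
      then show ?case
        by (simp add: energy_minimizer_eq_smoothing energy_smoothing
            minimal_energy_eq_double_integral T measurable_path)
    qed
  qed
  also have "\<dots> = (\<integral>\<^sup>+s. \<integral>\<^sup>+\<omega>. \<integral>\<^sup>+t. ?e s t \<omega> \<partial>segment T \<partial>M \<partial>segment T)"
    by (rule P.Fubini') measurable
  also have "\<dots> = (\<integral>\<^sup>+s. \<integral>\<^sup>+t. \<integral>\<^sup>+\<omega>. ?e s t \<omega> \<partial>M \<partial>segment T \<partial>segment T)"
    by (intro nn_integral_cong P.Fubini') measurable
  also have "\<dots> = (\<integral>\<^sup>+s. \<integral>\<^sup>+t. ennreal (neumann_kernel T s t * \<bar>s - t\<bar> powr (2 * H) / 2) \<partial>segment T \<partial>segment T)"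
  proof (intro nn_integral_cong)
    fix s t
    have "(\<integral>\<^sup>+\<omega>. ?e s t \<omega> \<partial>M)
        = (\<integral>\<^sup>+\<omega>. ennreal (neumann_kernel T s t / 2) * ennreal ((W s \<omega> - W t \<omega>)\<^sup>2) \<partial>M)"
      using neumann_kernel_nonneg[OF T, of s t]
      by (intro nn_integral_cong) (simp flip: ennreal_mult)
    also have "\<dots> = ennreal (neumann_kernel T s t / 2) * ennreal (\<bar>s - t\<bar> powr (2 * H))"
      by (subst nn_integral_cmult) (simp_all add: nn_increment_moment)
    also have "\<dots> = ennreal (neumann_kernel T s t * \<bar>s - t\<bar> powr (2 * H) / 2)"
      using neumann_kernel_nonneg[OF T, of s t] by (simp flip: ennreal_mult)
    finally show "(\<integral>\<^sup>+\<omega>. ?e s t \<omega> \<partial>M) = ennreal (neumann_kernel T s t * \<bar>s - t\<bar> powr (2 * H) / 2)" .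
  qed
  finally show ?thesis .
qed

end

section \<open>Gamma and Beta integrals\<close>

lemma has_bochner_integral_even:
  fixes \<phi> :: "real \<Rightarrow> real"
  assumes [measurable]: "\<phi> \<in> borel_measurable borel"
    and nonneg: "\<And>x. x > 0 \<Longrightarrow> \<phi> x \<ge> 0" and even: "\<And>x. \<phi> (- x) = \<phi> x"
    and int: "(\<phi> has_integral I) {0<..}"
  shows "has_bochner_integral lborel \<phi> (2 * I)"
proof -
  let ?\<psi> = "\<lambda>x. indicator {0<..} x * \<phi> x"
  have "(?\<psi> has_integral I) UNIV"
    using int unfolding has_integral_restrict_UNIV[of "{0<..}" \<phi> I, symmetric]
    by (rule has_integral_eq[rotated]) auto
  moreover have "I \<ge> 0" using has_integral_nonneg[OF int] nonneg by auto
  ultimately have pos: "has_bochner_integral lborel ?\<psi> I"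
    by (intro has_bochner_integral_nn_integral nn_integral_has_integral_lborel)
      (auto simp: nonneg indicator_def)
  then have "has_bochner_integral lborel (\<lambda>x. ?\<psi> (0 + (-1) * x)) (I /\<^sub>R \<bar>-1\<bar>)"
    by (subst (asm) lborel_has_bochner_integral_real_affine_iff[of "-1" _ _ 0]) auto
  then have "has_bochner_integral lborel (\<lambda>x. ?\<psi> x + ?\<psi> (- x)) (2 * I)"
    using has_bochner_integral_add[OF pos, of "\<lambda>x. ?\<psi> (- x)" I] unfolding mult_2 by simp
  moreover have "AE x in lborel. ?\<psi> x + ?\<psi> (- x) = \<phi> x"
    using AE_lborel_singleton[of 0] by eventually_elim (auto simp: even indicator_def)
  ultimately show ?thesis
    by (subst (asm) has_bochner_integral_cong_AE[where g = \<phi>]) auto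
qed

lemma Gamma_reflection_real:
  "Gamma x * Gamma (1 - x) = pi / sin (pi * x)" for x :: real
proof -
  have "complex_of_real (Gamma x * Gamma (1 - x)) = complex_of_real (pi / sin (pi * x))"
    using Gamma_reflection_complex[of "complex_of_real x"]
    by (metis (no_types, lifting) Gamma_complex_of_real of_real_1 of_real_diff of_real_divide of_real_mult sin_of_real)
  then show ?thesis by (simp only: of_real_eq_iff)
qed

text \<open>The substitution \<open>t = u\<^sup>2 / (1 + u\<^sup>2)\<close> maps \<open>(0,\<infinity>)\<close> onto \<open>(0,1)\<close> and turns the integrand into
  that of \<open>B(1 - H, H) = \<Gamma>(1 - H) \<Gamma>(H)\<close>, to which the reflection formula applies.\<close>
lemma has_integral_powr_over_one_plus_square:
  fixes H :: real
  assumes "0 < H" "H < 1"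
  shows "((\<lambda>u. 2 * u powr (1 - 2 * H) / (1 + u\<^sup>2)) has_integral (pi / sin (pi * H))) {0<..}"
proof -
  define g where "g u = u\<^sup>2 / (1 + u\<^sup>2)" for u :: real
  define f where "f t = t powr ((1 - H) - 1) * (1 - t) powr (H - 1)" for t :: real
  have pos: "1 + u\<^sup>2 > 0" for u :: real by (simp add: add_pos_nonneg)
  have der: "(g has_field_derivative 2 * u / (1 + u\<^sup>2)\<^sup>2) (at u within {0<..})" for u
    unfolding g_def using pos[of u]
    by (auto intro!: derivative_eq_intros simp: field_simps power2_eq_square)
  have inj: "inj_on g {0<..}"
  proof (rule inj_onI)
    fix x y :: real assume "x \<in> {0<..}" "y \<in> {0<..}" "g x = g y"
    then have "x\<^sup>2 = y\<^sup>2" using pos[of x] pos[of y] by (simp add: g_def field_simps)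
    then show "x = y" using \<open>x \<in> _\<close> \<open>y \<in> _\<close> by simp
  qed
  have img: "g ` {0<..} = {0<..<1}"
  proof (intro set_eqI iffI)
    fix t :: real assume t: "t \<in> {0<..<1}"
    then have "t / (1 - t) > 0" by simp
    moreover have "t = g (sqrt (t / (1 - t)))"
      using t by (simp add: g_def real_sqrt_divide power_divide divide_simps)
    ultimately show "t \<in> g ` {0<..}" by (metis greaterThan_iff imageI real_sqrt_gt_zero)
  qed (auto simp: g_def divide_simps add_pos_nonneg pos)
  have "(f has_integral Beta (1 - H) H) {0..1}"
    unfolding f_def by (rule has_integral_Beta_real) (use assms in auto)
  then have "(f has_integral Beta (1 - H) H) {0<..<1}"
    using has_integral_Icc_iff_Ioo by blast
  moreover have "Beta (1 - H) H = pi / sin (pi * H)"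
    using Gamma_reflection_real[of H] by (simp add: Beta_def Gamma_fact mult.commute)
  ultimately have "f absolutely_integrable_on (g ` {0<..}) \<and> integral (g ` {0<..}) f = pi / sin (pi * H)"
    unfolding img
    by (auto intro!: nonnegative_absolutely_integrable_1 simp: f_def has_integral_iff)
  then have "((\<lambda>u. \<bar>2 * u / (1 + u\<^sup>2)\<^sup>2\<bar> * f (g u)) has_integral (pi / sin (pi * H))) {0<..}"
    by (subst (asm) has_absolute_integral_change_of_variables_1'[OF _ der inj, symmetric])
      (auto simp: has_integral_iff absolutely_integrable_on_def)
  moreover have "\<bar>2 * u / (1 + u\<^sup>2)\<^sup>2\<bar> * f (g u) = 2 * u powr (1 - 2 * H) / (1 + u\<^sup>2)"
    if "u \<in> {0<..}" for u
  proof -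
    have u: "u > 0" using that by simp
    have "1 - g u = 1 / (1 + u\<^sup>2)" using pos[of u] by (simp add: g_def field_simps)
    then have "f (g u) = (u\<^sup>2) powr (- H) * (1 + u\<^sup>2) powr H * (1 + u\<^sup>2) powr (1 - H)"
      using pos[of u] u
      by (simp add: f_def g_def powr_divide powr_minus field_simps powr_diff)
    also have "\<dots> = u powr (- 2 * H) * (1 + u\<^sup>2)"
      using pos[of u] u by (simp add: powr_powr powr_add[symmetric] flip: powr_numeral)
    finally have "f (g u) = u powr (- 2 * H) * (1 + u\<^sup>2)" .
    moreover have "u powr (1 - 2 * H) = u * u powr (- 2 * H)"
      using u by (simp add: powr_diff powr_minus field_simps)
    ultimately show ?thesis using pos[of u] u
      by (simp add: abs_of_pos power2_eq_square[of "1 + u\<^sup>2"])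
  qed
  ultimately show ?thesis by (rule has_integral_eq[rotated])
qed

lemma spectral_integral_eq:
  fixes H :: real
  assumes "0 < H" "H < 1"
  shows "(LINT u:UNIV - {0}|lborel. u\<^sup>2 / (1 + u\<^sup>2) * (c / \<bar>u\<bar> powr (2 * H + 1))) = c * (pi / sin (pi * H))"
proof -
  let ?\<phi> = "\<lambda>u::real. u\<^sup>2 / (1 + u\<^sup>2) / \<bar>u\<bar> powr (2 * H + 1)"
  have half: "2 * x / y / 2 = x / y" for x y :: real by simp
  have "(?\<phi> has_integral (pi / sin (pi * H) / 2)) {0<..}"
  proof (rule has_integral_eq)
    show "((\<lambda>u. 2 * u powr (1 - 2 * H) / (1 + u\<^sup>2) / 2) has_integral (pi / sin (pi * H) / 2)) {0<..}"
      by (rule has_integral_divide[OF has_integral_powr_over_one_plus_square[OF assms]])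
    show "2 * u powr (1 - 2 * H) / (1 + u\<^sup>2) / 2 = ?\<phi> u" if "u \<in> {0<..}" for u
    proof -
      have "u powr (1 - 2 * H) * u powr (2 * H + 1) = u\<^sup>2"
        using that by (simp flip: powr_add)
      then have "?\<phi> u = u powr (1 - 2 * H) * u powr (2 * H + 1) / (1 + u\<^sup>2) / u powr (2 * H + 1)"
        using that by simp
      moreover have "2 * u powr (1 - 2 * H) / (1 + u\<^sup>2) / 2 = u powr (1 - 2 * H) / (1 + u\<^sup>2)"
        by (rule half)
      ultimately show ?thesis using that by simp
    qed
  qed
  then have "has_bochner_integral lborel ?\<phi> (2 * (pi / sin (pi * H) / 2))"
    by (intro has_bochner_integral_even) (auto intro!: divide_nonneg_nonneg)
  then have "(\<integral>u. ?\<phi> u \<partial>lborel) = pi / sin (pi * H)"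
    by (simp add: has_bochner_integral_integral_eq)
  moreover have "(LINT u:UNIV - {0}|lborel. u\<^sup>2 / (1 + u\<^sup>2) * (c / \<bar>u\<bar> powr (2 * H + 1)))
      = (\<integral>u. c * ?\<phi> u \<partial>lborel)"
    unfolding set_lebesgue_integral_def by (intro Bochner_Integration.integral_cong) (auto simp: indicator_def)
  moreover have "(\<integral>u. c * ?\<phi> u \<partial>lborel) = c * (\<integral>u. ?\<phi> u \<partial>lborel)"
    by (rule integral_mult_right_zero)
  ultimately show ?thesis by metis
qed

lemma nn_integral_abs_powr_exp:
  fixes a :: real
  assumes "a > 0"
  shows "(\<integral>\<^sup>+x. ennreal (\<bar>x\<bar> powr a * exp (- \<bar>x\<bar>)) \<partial>lborel) = ennreal (2 * Gamma (a + 1))"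
proof -
  let ?\<phi> = "\<lambda>x::real. \<bar>x\<bar> powr a * exp (- \<bar>x\<bar>)"
  have "((\<lambda>t. t powr (a + 1 - 1) / exp t) has_integral Gamma (a + 1)) {0..}"
    by (rule Gamma_integral_real) (use assms in auto)
  then have "((\<lambda>t. t powr (a + 1 - 1) / exp t) has_integral Gamma (a + 1)) {0<..}"
  proof (rule iffD1[OF has_integral_spike_set_eq, rotated 2])
    show "negligible {x \<in> {0..} - {0<..}. x powr (a + 1 - 1) / exp x \<noteq> 0}"
      by (rule negligible_subset[OF negligible_sing[of 0]]) auto
    show "negligible {x \<in> {0<..} - {0..}. x powr (a + 1 - 1) / exp x \<noteq> 0}"
      by (rule negligible_subset[OF negligible_sing[of 0]]) auto
  qed
  then have "(?\<phi> has_integral Gamma (a + 1)) {0<..}"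
    by (rule has_integral_eq[rotated]) (auto simp: exp_minus field_simps)
  then have "has_bochner_integral lborel ?\<phi> (2 * Gamma (a + 1))"
    by (intro has_bochner_integral_even) auto
  then show ?thesis
    by (subst nn_integral_eq_integral) (auto simp: has_bochner_integral_iff)
qed

section \<open>Long intervals\<close>

lemma mult_divide_ennreal: "0 < T \<Longrightarrow> (ennreal T * y) / ennreal T = y"
  by (subst mult.commute, rule mult_divide_eq_ennreal) auto

text \<open>The domination for the passage to the limit, uniform in \<open>T\<close>: \<open>cosh y \<le> exp y\<close> for
  \<open>y \<ge> 0\<close>, and \<open>exp T \<le> 4 sinh T\<close> once \<open>T \<ge> 1\<close>.\<close>
lemma neumann_kernel_le_exp:
  assumes "1 \<le> T" "s \<in> {0..T}" "t \<in> {0..T}"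
  shows "neumann_kernel T s t \<le> 4 * exp (- \<bar>s - t\<bar>)"
proof -
  have "cosh (T - \<bar>s - t\<bar>) \<le> exp (T - \<bar>s - t\<bar>)"
    using assms by (auto simp: cosh_field_def abs_if)
  moreover have "exp T / 4 \<le> sinh T"
  proof -
    have "2 \<le> exp T" using exp_ge_add_one_self[of T] assms by linarith
    moreover have "exp (- T) \<le> 1" using assms by simp
    ultimately have "exp (- T) * 2 \<le> exp T" by linarith
    then show ?thesis by (simp add: sinh_field_def)
  qed
  ultimately have "cosh (T - \<bar>s - t\<bar>) / sinh T \<le> exp (T - \<bar>s - t\<bar>) / (exp T / 4)"
    using assms by (intro frac_le) auto
  also have "\<dots> = 4 * exp (- \<bar>s - t\<bar>)" by (simp add: exp_diff exp_minus field_simps)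
  finally show ?thesis using neumann_kernel_le[of T s t] assms by simp
qed

text \<open>Away from the two endpoints the kernel converges to the Green function of \<open>f - f''\<close> on the
  line. Numerator and denominator are multiplied by \<open>exp (-T)\<close>; every exponential but one
  then decays.\<close>
lemma neumann_kernel_tendsto:
  fixes \<sigma> x :: real
  assumes \<sigma>: "0 < \<sigma>" "\<sigma> < 1"
  shows "((\<lambda>T. neumann_kernel T (T * \<sigma>) (T * \<sigma> + x)) \<longlongrightarrow> exp (- \<bar>x\<bar>) / 2) at_top"
proof -
  have "((\<lambda>T. (exp (- \<bar>x\<bar>) + exp (\<bar>x\<bar> - 2 * T) + (exp (- 2 * T * \<sigma> - x) + exp (x - 2 * T * (1 - \<sigma>))))
      / (2 * (1 - exp (- 2 * T)))) \<longlongrightarrow> (exp (- \<bar>x\<bar>) + 0 + (0 + 0)) / (2 * (1 - 0))) at_top"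
  proof (intro tendsto_intros)
    show "((\<lambda>T. exp (\<bar>x\<bar> - 2 * T)) \<longlongrightarrow> 0) at_top" by real_asymp
    show "((\<lambda>T. exp (- 2 * T)) \<longlongrightarrow> (0::real)) at_top" by real_asymp
    show "((\<lambda>T. exp (- 2 * T * \<sigma> - x)) \<longlongrightarrow> 0) at_top" using \<sigma> by real_asymp
    have "1 - \<sigma> > 0" using \<sigma> by simp
    then show "((\<lambda>T. exp (x - 2 * T * (1 - \<sigma>))) \<longlongrightarrow> 0) at_top" by real_asymp
  qed simp
  moreover have "\<forall>\<^sub>F T in at_top. (exp (- \<bar>x\<bar>) + exp (\<bar>x\<bar> - 2 * T) + (exp (- 2 * T * \<sigma> - x) + exp (x - 2 * T * (1 - \<sigma>))))
      / (2 * (1 - exp (- 2 * T))) = neumann_kernel T (T * \<sigma>) (T * \<sigma> + x)"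
    using eventually_gt_at_top[of 0]
  proof eventually_elim
    case (elim T)
    have "(exp (- \<bar>x\<bar>) + exp (\<bar>x\<bar> - 2 * T) + (exp (- 2 * T * \<sigma> - x) + exp (x - 2 * T * (1 - \<sigma>))))
      / (2 * (1 - exp (- 2 * T)))
      = (exp T * (exp (- \<bar>x\<bar>) + exp (\<bar>x\<bar> - 2 * T) + (exp (- 2 * T * \<sigma> - x) + exp (x - 2 * T * (1 - \<sigma>)))))
      / (exp T * (2 * (1 - exp (- 2 * T))))" by simp
    also have "exp T * (2 * (1 - exp (- 2 * T))) = 4 * sinh T"
      by (simp add: sinh_field_def algebra_simps flip: exp_add)
    also have "exp T * (exp (- \<bar>x\<bar>) + exp (\<bar>x\<bar> - 2 * T) + (exp (- 2 * T * \<sigma> - x) + exp (x - 2 * T * (1 - \<sigma>))))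
      = 2 * cosh (T - \<bar>x\<bar>) + 2 * cosh (T - T * \<sigma> - (T * \<sigma> + x))"
      by (simp add: cosh_field_def algebra_simps add_divide_distrib flip: exp_add)
    finally show ?case
      using elim by (simp add: neumann_kernel_alt field_simps)
  qed
  ultimately have "((\<lambda>T. neumann_kernel T (T * \<sigma>) (T * \<sigma> + x)) \<longlongrightarrow> (exp (- \<bar>x\<bar>) + 0 + (0 + 0)) / (2 * (1 - 0))) at_top"
    by (rule Lim_transform_eventually)
  then show ?thesis by simp
qed

text \<open>The integrand of the mean energy per unit length in the coordinates \<open>s = T\<sigma>\<close>, \<open>t = s + x\<close>.
  The endpoints \<open>\<sigma> = 0\<close> and \<open>\<sigma> = 1\<close>, where the kernel has a different limit, are left out.\<close>
definition rescaled_density :: "real \<Rightarrow> real \<Rightarrow> real \<times> real \<Rightarrow> real" where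
  "rescaled_density a T = (\<lambda>(\<sigma>, x). indicator {0<..<1} \<sigma> * (indicator {0..T} (T * \<sigma> + x) *
     (neumann_kernel T (T * \<sigma>) (T * \<sigma> + x) * \<bar>x\<bar> powr a / 2)))"

lemma measurable_rescaled_density [measurable]:
  "rescaled_density a T \<in> borel_measurable (borel \<Otimes>\<^sub>M borel)"
  unfolding rescaled_density_def by measurable

lemma double_integral_rescale:
  assumes T: "0 < T"
  shows "(\<integral>\<^sup>+s. \<integral>\<^sup>+t. ennreal (neumann_kernel T s t * \<bar>s - t\<bar> powr a / 2) \<partial>segment T \<partial>segment T)
    = ennreal T * (\<integral>\<^sup>+p. ennreal (rescaled_density a T p) \<partial>(lborel \<Otimes>\<^sub>M lborel))"
proof -
  let ?k = "\<lambda>s t. neumann_kernel T s t * \<bar>s - t\<bar> powr a / 2"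
  have "(\<integral>\<^sup>+s. \<integral>\<^sup>+t. ennreal (?k s t) \<partial>segment T \<partial>segment T)
      = (\<integral>\<^sup>+s. (\<integral>\<^sup>+t. ennreal (?k s t) * indicator {0..T} t \<partial>lborel) * indicator {0..T} s \<partial>lborel)"
    by (subst nn_integral_segment, measurable) (auto intro!: nn_integral_cong nn_integral_segment simp: nn_integral_segment)
  also have "\<dots> = (\<integral>\<^sup>+s. (\<integral>\<^sup>+x. ennreal (?k s (s + x)) * indicator {0..T} (s + x) \<partial>lborel) * indicator {0..T} s \<partial>lborel)"
  proof (intro nn_integral_cong)
    fix s :: real
    have "(\<integral>\<^sup>+t. ennreal (?k s t) * indicator {0..T} t \<partial>lborel)
      = (\<integral>\<^sup>+x. ennreal (?k s (s + x)) * indicator {0..T} (s + x) \<partial>lborel)"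
      using nn_integral_real_affine[of "\<lambda>t. ennreal (?k s t) * indicator {0..T} t" 1 s] by simp
    then show "(\<integral>\<^sup>+t. ennreal (?k s t) * indicator {0..T} t \<partial>lborel) * indicator {0..T} s
      = (\<integral>\<^sup>+x. ennreal (?k s (s + x)) * indicator {0..T} (s + x) \<partial>lborel) * indicator {0..T} s"
      by simp
  qed
  also have "\<dots> = ennreal T * (\<integral>\<^sup>+\<sigma>. (\<integral>\<^sup>+x. ennreal (?k (T * \<sigma>) (T * \<sigma> + x)) * indicator {0..T} (T * \<sigma> + x) \<partial>lborel)
      * indicator {0..T} (T * \<sigma>) \<partial>lborel)"
    using T nn_integral_real_affine[of "\<lambda>s. (\<integral>\<^sup>+x. ennreal (?k s (s + x)) * indicator {0..T} (s + x) \<partial>lborel) * indicator {0..T} s" T 0]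
    by simp
  also have "(\<integral>\<^sup>+\<sigma>. (\<integral>\<^sup>+x. ennreal (?k (T * \<sigma>) (T * \<sigma> + x)) * indicator {0..T} (T * \<sigma> + x) \<partial>lborel)
      * indicator {0..T} (T * \<sigma>) \<partial>lborel)
    = (\<integral>\<^sup>+\<sigma>. \<integral>\<^sup>+x. ennreal (rescaled_density a T (\<sigma>, x)) \<partial>lborel \<partial>lborel)"
  proof (rule nn_integral_cong_AE)
    show "AE \<sigma> in lborel. (\<integral>\<^sup>+x. ennreal (?k (T * \<sigma>) (T * \<sigma> + x)) * indicator {0..T} (T * \<sigma> + x) \<partial>lborel)
      * indicator {0..T} (T * \<sigma>) = (\<integral>\<^sup>+x. ennreal (rescaled_density a T (\<sigma>, x)) \<partial>lborel)"
      using AE_lborel_singleton[of 0] AE_lborel_singleton[of 1]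
    proof eventually_elim
      case (elim \<sigma>)
      have ind: "indicator {0..T} (T * \<sigma>) = (indicator {0<..<1} \<sigma> :: ennreal)"
        using elim T by (auto simp: indicator_def zero_le_mult_iff mult_le_cancel_left1)
      have "(\<integral>\<^sup>+x. ennreal (?k (T * \<sigma>) (T * \<sigma> + x)) * indicator {0..T} (T * \<sigma> + x) \<partial>lborel) * indicator {0..T} (T * \<sigma>)
        = (\<integral>\<^sup>+x. ennreal (?k (T * \<sigma>) (T * \<sigma> + x)) * indicator {0..T} (T * \<sigma> + x) * indicator {0<..<1} \<sigma> \<partial>lborel)"
        unfolding ind by (rule nn_integral_multc[symmetric]) measurable
      also have "\<dots> = (\<integral>\<^sup>+x. ennreal (rescaled_density a T (\<sigma>, x)) \<partial>lborel)"
        by (intro nn_integral_cong) (auto simp: rescaled_density_def indicator_def)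
      finally show ?case .
    qed
  qed
  also have "\<dots> = (\<integral>\<^sup>+p. ennreal (rescaled_density a T p) \<partial>(lborel \<Otimes>\<^sub>M lborel))"
    by (rule lborel.nn_integral_fst[where f = "\<lambda>p. ennreal (rescaled_density a T p)"]) measurable
  finally show ?thesis .
qed

text \<open>The limit of the rescaled densities for \<open>c = 1/4\<close>, and a dominating function for \<open>c = 2\<close>.\<close>
definition strip_density :: "real \<Rightarrow> real \<Rightarrow> real \<times> real \<Rightarrow> real" where
  "strip_density a c = (\<lambda>(\<sigma>, x). indicator {0<..<1} \<sigma> * (c * (\<bar>x\<bar> powr a * exp (- \<bar>x\<bar>))))"

lemma measurable_strip_density [measurable]:
  "strip_density a c \<in> borel_measurable (borel \<Otimes>\<^sub>M borel)"
  unfolding strip_density_def by measurable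

lemma nn_integral_strip:
  assumes "0 < a" "0 \<le> c"
  shows "(\<integral>\<^sup>+p. ennreal (strip_density a c p) \<partial>(lborel \<Otimes>\<^sub>M lborel))
    = ennreal (2 * c * Gamma (a + 1))"
proof -
  have "(\<integral>\<^sup>+p. ennreal (strip_density a c p) \<partial>(lborel \<Otimes>\<^sub>M lborel))
      = (\<integral>\<^sup>+\<sigma>. \<integral>\<^sup>+x. ennreal (strip_density a c (\<sigma>, x)) \<partial>lborel \<partial>lborel)"
    by (rule lborel.nn_integral_fst[where f = "\<lambda>p. ennreal (strip_density a c p)", symmetric]) measurable
  also have "\<dots> = (\<integral>\<^sup>+\<sigma>. \<integral>\<^sup>+x. indicator {0<..<1} \<sigma> * (ennreal c * ennreal (\<bar>x\<bar> powr a * exp (- \<bar>x\<bar>)))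
      \<partial>lborel \<partial>(lborel :: real measure))"
    using \<open>0 \<le> c\<close> by (intro nn_integral_cong) (auto simp: strip_density_def indicator_def ennreal_mult)
  also have "\<dots> = (\<integral>\<^sup>+\<sigma>. indicator {0<..<1} \<sigma> * (ennreal c * ennreal (2 * Gamma (a + 1))) \<partial>(lborel :: real measure))"
    using assms by (intro nn_integral_cong) (simp add: nn_integral_cmult nn_integral_abs_powr_exp)
  also have "\<dots> = ennreal c * ennreal (2 * Gamma (a + 1))"
    by (subst nn_integral_multc) auto
  also have "\<dots> = ennreal (2 * c * Gamma (a + 1))"
    using assms by (simp add: mult_ac flip: ennreal_mult)
  finally show ?thesis .
qed

lemma rescaled_integral_tendsto:
  assumes a: "0 < a"
  shows "((\<lambda>T. \<integral>\<^sup>+p. ennreal (rescaled_density a T p) \<partial>(lborel \<Otimes>\<^sub>M lborel)) \<longlongrightarrow> ennreal (Gamma (a + 1) / 2)) at_top"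
proof (rule tendsto_at_topI_sequentially)
  fix X :: "nat \<Rightarrow> real" assume X: "filterlim X at_top sequentially"
  \<comment> \<open>The domination needs \<open>T \<ge> 1\<close> for every member of the sequence.\<close>
  define Y where "Y n = max 1 (X n)" for n
  have ev: "\<forall>\<^sub>F n in sequentially. Y n = X n"
    using X[unfolded filterlim_at_top, rule_format, of 1] by eventually_elim (simp add: Y_def)
  then have Y: "filterlim Y at_top sequentially"
    using X by (subst filterlim_cong[OF refl refl]) auto
  have Y1: "1 \<le> Y n" for n by (simp add: Y_def)
  have "(\<lambda>n. \<integral>\<^sup>+p. ennreal (rescaled_density a (Y n) p) \<partial>(lborel \<Otimes>\<^sub>M lborel))
      \<longlonglongrightarrow> (\<integral>\<^sup>+p. ennreal (strip_density a (1/4) p) \<partial>(lborel \<Otimes>\<^sub>M lborel))"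
  proof (rule nn_integral_dominated_convergence[where w = "\<lambda>p. ennreal (strip_density a 2 p)"])
    show "(\<integral>\<^sup>+p. ennreal (strip_density a 2 p) \<partial>(lborel \<Otimes>\<^sub>M lborel)) < \<infinity>"
      using nn_integral_strip[OF a, of 2] by simp
    show "AE p in lborel \<Otimes>\<^sub>M lborel. ennreal (rescaled_density a (Y n) p) \<le> ennreal (strip_density a 2 p)" for n
    proof (rule AE_I2)
      fix p :: "real \<times> real"
      obtain \<sigma> x where p: "p = (\<sigma>, x)" by (cases p)
      show "ennreal (rescaled_density a (Y n) p) \<le> ennreal (strip_density a 2 p)"
      proof (cases "\<sigma> \<in> {0<..<1} \<and> Y n * \<sigma> + x \<in> {0..Y n}")
        case True
        then have "Y n * \<sigma> \<in> {0..Y n}" using Y1[of n] by (auto simp: mult_le_cancel_left1)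
        then have "neumann_kernel (Y n) (Y n * \<sigma>) (Y n * \<sigma> + x) \<le> 4 * exp (- \<bar>Y n * \<sigma> - (Y n * \<sigma> + x)\<bar>)"
          using True Y1 by (intro neumann_kernel_le_exp) auto
        then have "neumann_kernel (Y n) (Y n * \<sigma>) (Y n * \<sigma> + x) * \<bar>x\<bar> powr a \<le> 4 * exp (- \<bar>x\<bar>) * \<bar>x\<bar> powr a"
          by (intro mult_right_mono) auto
        then show ?thesis
          using True by (intro ennreal_leI) (simp add: p rescaled_density_def strip_density_def mult_ac)
      qed (auto simp: p rescaled_density_def strip_density_def indicator_def)
    qed
    show "AE p in lborel \<Otimes>\<^sub>M lborel. (\<lambda>n. ennreal (rescaled_density a (Y n) p)) \<longlonglongrightarrow> ennreal (strip_density a (1/4) p)"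
    proof (rule AE_I2)
      fix p :: "real \<times> real"
      obtain \<sigma> x where p: "p = (\<sigma>, x)" by (cases p)
      show "(\<lambda>n. ennreal (rescaled_density a (Y n) p)) \<longlonglongrightarrow> ennreal (strip_density a (1/4) p)"
      proof (cases "0 < \<sigma> \<and> \<sigma> < 1")
        case True
        then have \<sigma>: "0 < \<sigma>" "\<sigma> < 1" by auto
        have "\<forall>\<^sub>F T in at_top. 0 \<le> T * \<sigma> + x" "\<forall>\<^sub>F T in at_top. 0 \<le> T * (1 - \<sigma>) - x"
          using \<sigma> by real_asymp+
        then have "\<forall>\<^sub>F T in at_top. neumann_kernel T (T * \<sigma>) (T * \<sigma> + x) * \<bar>x\<bar> powr a / 2 = rescaled_density a T (\<sigma>, x)"
          by eventually_elim (use \<sigma> in \<open>auto simp: rescaled_density_def algebra_simps\<close>)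
        moreover have "((\<lambda>T. neumann_kernel T (T * \<sigma>) (T * \<sigma> + x) * \<bar>x\<bar> powr a / 2)
            \<longlongrightarrow> exp (- \<bar>x\<bar>) / 2 * \<bar>x\<bar> powr a / 2) at_top"
          by (intro tendsto_intros neumann_kernel_tendsto \<sigma>) auto
        ultimately have "((\<lambda>T. rescaled_density a T (\<sigma>, x)) \<longlongrightarrow> exp (- \<bar>x\<bar>) / 2 * \<bar>x\<bar> powr a / 2) at_top"
          by (rule Lim_transform_eventually[rotated])
        then have "((\<lambda>n. rescaled_density a (Y n) (\<sigma>, x)) \<longlonglongrightarrow> exp (- \<bar>x\<bar>) / 2 * \<bar>x\<bar> powr a / 2)"
          by (rule filterlim_compose[OF _ Y])
        then show ?thesis
          using \<sigma> by (intro tendsto_ennrealI) (simp add: p strip_density_def mult_ac)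
      qed (auto simp: p rescaled_density_def strip_density_def)
    qed
  qed measurable
  also have "(\<integral>\<^sup>+p. ennreal (strip_density a (1/4) p) \<partial>(lborel \<Otimes>\<^sub>M lborel)) = ennreal (Gamma (a + 1) / 2)"
    using nn_integral_strip[OF a, of "1/4"] by simp
  finally show "(\<lambda>n. \<integral>\<^sup>+p. ennreal (rescaled_density a (X n) p) \<partial>(lborel \<Otimes>\<^sub>M lborel)) \<longlonglongrightarrow> ennreal (Gamma (a + 1) / 2)"
    by (rule Lim_transform_eventually) (use ev in \<open>eventually_elim, simp\<close>)
qed

theorem corollary3p2:
  fixes M :: "'a measure" and H :: real and W :: "real \<Rightarrow> 'a \<Rightarrow> real"
  assumes "fractional_brownian_motion M H W"
  defines "mean_energy \<equiv> \<lambda>T::real.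
    \<integral>\<^sup>+\<omega>. energy T (energy_minimizer T (\<lambda>s. W s \<omega>)) (\<lambda>s. W s \<omega>) \<partial>M"
  shows "\<exists>C::real.
      ((\<lambda>T. mean_energy T / ennreal T) \<longlongrightarrow> ennreal C) at_top \<and>
      C = (LINT u:UNIV - {0}|lborel.
            u\<^sup>2 / (1 + u\<^sup>2) * (spectral_const H / \<bar>u\<bar> powr (2 * H + 1))) \<and>
      C = spectral_const H * (pi / sin (pi * H)) \<and>
      C = Gamma (2 * H + 1) / 2 \<and>
      (H = 1 / 2 \<longrightarrow> C = 1 / 2)"
proof -
  interpret fractional_brownian_motion M H W by fact
  have sin_pos: "sin (pi * H) > 0"
    using H_pos H_less_1 by (intro sin_gt_zero) auto
  have const: "spectral_const H * (pi / sin (pi * H)) = Gamma (2 * H + 1) / 2"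
    using sin_pos by (simp add: spectral_const_def field_simps)
  have "((\<lambda>T. mean_energy T / ennreal T) \<longlongrightarrow> ennreal (Gamma (2 * H + 1) / 2)) at_top"
  proof (rule Lim_transform_eventually)
    show "((\<lambda>T. \<integral>\<^sup>+p. ennreal (rescaled_density (2 * H) T p) \<partial>(lborel \<Otimes>\<^sub>M lborel))
        \<longlongrightarrow> ennreal (Gamma (2 * H + 1) / 2)) at_top"
      by (rule rescaled_integral_tendsto) (use H_pos in simp)
    show "\<forall>\<^sub>F T in at_top. (\<integral>\<^sup>+p. ennreal (rescaled_density (2 * H) T p) \<partial>(lborel \<Otimes>\<^sub>M lborel))
        = mean_energy T / ennreal T"
      using eventually_gt_at_top[of 0]
      by eventually_elim
        (simp add: mean_energy_def mean_energy_eq double_integral_rescale mult_divide_ennreal)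
  qed
  moreover have "H = 1 / 2 \<longrightarrow> Gamma (2 * H + 1) / 2 = 1 / 2"
  proof
    assume "H = 1 / 2"
    then have "2 * H + 1 = 2" by simp
    moreover have "Gamma (2::real) = 1" by (simp add: Gamma_numeral)
    ultimately show "Gamma (2 * H + 1) / 2 = 1 / 2" by simp
  qed
  ultimately show ?thesis
    using spectral_integral_eq[OF H_pos H_less_1, of "spectral_const H"] const
    by (intro exI[of _ "Gamma (2 * H + 1) / 2"]) simp
qed

end
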